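(* Let $R$ be a field of characteristic different from $2$ and let $k\ge1$ be an integer with $k\equiv 2$ or $k\equiv 3 \pmod 4$. Then there is no near-group category over $R$ with fusion rule $(G,k)$ where $G$ is the trivial group; that is, there is no semisimple rigid monoidal $R$-linear category whose simple objects are (up to isomorphism) exactly the unit $\epsilon$ and one further object $m$ with $m\otimes m\cong \epsilon\oplus k\cdot m$.
   Context: A near-group category with fusion rule $(\{\epsilon\},k)$ over $R$: an $R$-linear category with finite-dimensional hom-spaces, exactly two isomorphism classes of simple objects $\epsilon,m$ with $\mathrm{hom}(s,s)\cong R$ for a simple $s$ and $\mathrm{hom}(\epsilon,m)=0$, every object a finite direct sum of simples; a bilinear tensor product with unit object $\epsilon$ and natural associativity isomorphisms satisfying the pentagon axiom; duality: every object $x$ has a dual $x^*$ with evaluation $x^*\otimes x\to\epsilon$ and coevaluation $\epsilon\to x\otimes x^*$ satisfying the zig-zag identities; and the fusion rule $m\otimes m\cong\epsilon\oplus k\cdot m$. *)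

theory Defs
  imports Main
begin

record ('o, 'm, 'r) cat_data =
  Obj    :: "'o set"
  Hom    :: "'o \<Rightarrow> 'o \<Rightarrow> 'm set"
  cmp    :: "'m \<Rightarrow> 'm \<Rightarrow> 'm"          (* cmp g f = g after f *)
  idm    :: "'o \<Rightarrow> 'm"
  madd   :: "'m \<Rightarrow> 'm \<Rightarrow> 'm"
  mzero  :: "'o \<Rightarrow> 'o \<Rightarrow> 'm"
  msmul  :: "'r \<Rightarrow> 'm \<Rightarrow> 'm"
  tens   :: "'o \<Rightarrow> 'o \<Rightarrow> 'o"
  tensm  :: "'m \<Rightarrow> 'm \<Rightarrow> 'm"
  unitob :: "'o"
  asc    :: "'o \<Rightarrow> 'o \<Rightarrow> 'o \<Rightarrow> 'm"    (* (a*b)*c \<rightarrow> a*(b*c) *)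
  lu     :: "'o \<Rightarrow> 'm"                (* unit*a \<rightarrow> a *)
  ru     :: "'o \<Rightarrow> 'm"                (* a*unit \<rightarrow> a *)
  dual   :: "'o \<Rightarrow> 'o"
  ev     :: "'o \<Rightarrow> 'm"                (* dual x * x \<rightarrow> unit *)
  coev   :: "'o \<Rightarrow> 'm"                (* unit \<rightarrow> x * dual x *)

definition vspace :: "'m set \<Rightarrow> ('m \<Rightarrow> 'm \<Rightarrow> 'm) \<Rightarrow> 'm \<Rightarrow> ('r::field \<Rightarrow> 'm \<Rightarrow> 'm) \<Rightarrow> bool" where
  "vspace V ad z sm \<longleftrightarrow>
     z \<in> V \<and> (\<forall>x\<in>V. \<forall>y\<in>V. ad x y \<in> V) \<and> (\<forall>c. \<forall>x\<in>V. sm c x \<in> V) \<and>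
     (\<forall>x\<in>V. \<forall>y\<in>V. \<forall>w\<in>V. ad (ad x y) w = ad x (ad y w)) \<and>
     (\<forall>x\<in>V. \<forall>y\<in>V. ad x y = ad y x) \<and>
     (\<forall>x\<in>V. ad z x = x) \<and>
     (\<forall>x\<in>V. \<exists>y\<in>V. ad x y = z) \<and>
     (\<forall>c. \<forall>x\<in>V. \<forall>y\<in>V. sm c (ad x y) = ad (sm c x) (sm c y)) \<and>
     (\<forall>c d. \<forall>x\<in>V. sm (c + d) x = ad (sm c x) (sm d x)) \<and>
     (\<forall>c d. \<forall>x\<in>V. sm (c * d) x = sm c (sm d x)) \<and>
     (\<forall>x\<in>V. sm 1 x = x)"

inductive_set lspan :: "('m \<Rightarrow> 'm \<Rightarrow> 'm) \<Rightarrow> 'm \<Rightarrow> ('r \<Rightarrow> 'm \<Rightarrow> 'm) \<Rightarrow> 'm set \<Rightarrow> 'm set"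
  for ad z sm B where
  lspan_zero: "z \<in> lspan ad z sm B"
| lspan_step: "b \<in> B \<Longrightarrow> v \<in> lspan ad z sm B \<Longrightarrow> ad (sm c b) v \<in> lspan ad z sm B"

definition findim :: "'m set \<Rightarrow> ('m \<Rightarrow> 'm \<Rightarrow> 'm) \<Rightarrow> 'm \<Rightarrow> ('r \<Rightarrow> 'm \<Rightarrow> 'm) \<Rightarrow> bool" where
  "findim V ad z sm \<longleftrightarrow> (\<exists>B. finite B \<and> B \<subseteq> V \<and> V \<subseteq> lspan ad z sm B)"

definition linear_cat :: "('o, 'm, 'r::field) cat_data \<Rightarrow> bool" where
  "linear_cat C \<longleftrightarrow>
     (\<forall>a b. a \<notin> Obj C \<or> b \<notin> Obj C \<longrightarrow> Hom C a b = {}) \<and>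
     (\<forall>a b a' b' f. f \<in> Hom C a b \<longrightarrow> f \<in> Hom C a' b' \<longrightarrow> a = a' \<and> b = b') \<and>
     (\<forall>a\<in>Obj C. idm C a \<in> Hom C a a) \<and>
     (\<forall>a\<in>Obj C. \<forall>b\<in>Obj C. \<forall>c\<in>Obj C. \<forall>f\<in>Hom C a b. \<forall>g\<in>Hom C b c.
         cmp C g f \<in> Hom C a c) \<and>
     (\<forall>a\<in>Obj C. \<forall>b\<in>Obj C. \<forall>c\<in>Obj C. \<forall>d\<in>Obj C.
        \<forall>f\<in>Hom C a b. \<forall>g\<in>Hom C b c. \<forall>h\<in>Hom C c d.
         cmp C h (cmp C g f) = cmp C (cmp C h g) f) \<and>
     (\<forall>a\<in>Obj C. \<forall>b\<in>Obj C. \<forall>f\<in>Hom C a b.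
         cmp C f (idm C a) = f \<and> cmp C (idm C b) f = f) \<and>
     (\<forall>a\<in>Obj C. \<forall>b\<in>Obj C. vspace (Hom C a b) (madd C) (mzero C a b) (msmul C)) \<and>
     (\<forall>a\<in>Obj C. \<forall>b\<in>Obj C. findim (Hom C a b) (madd C) (mzero C a b) (msmul C)) \<and>
     (\<forall>a\<in>Obj C. \<forall>b\<in>Obj C. \<forall>c\<in>Obj C. \<forall>f\<in>Hom C a b. \<forall>f'\<in>Hom C a b.
        \<forall>g\<in>Hom C b c. \<forall>g'\<in>Hom C b c. \<forall>r.
         cmp C g (madd C f f') = madd C (cmp C g f) (cmp C g f') \<and>
         cmp C (madd C g g') f = madd C (cmp C g f) (cmp C g' f) \<and>
         cmp C g (msmul C r f) = msmul C r (cmp C g f) \<and>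
         cmp C (msmul C r g) f = msmul C r (cmp C g f))"

definition is_iso :: "('o, 'm, 'r) cat_data \<Rightarrow> 'o \<Rightarrow> 'o \<Rightarrow> 'm \<Rightarrow> bool" where
  "is_iso C a b f \<longleftrightarrow> f \<in> Hom C a b \<and>
     (\<exists>g\<in>Hom C b a. cmp C g f = idm C a \<and> cmp C f g = idm C b)"

definition iso_obj :: "('o, 'm, 'r) cat_data \<Rightarrow> 'o \<Rightarrow> 'o \<Rightarrow> bool" where
  "iso_obj C a b \<longleftrightarrow> (\<exists>f. is_iso C a b f)"

definition minv :: "('o, 'm, 'r) cat_data \<Rightarrow> 'o \<Rightarrow> 'o \<Rightarrow> 'm \<Rightarrow> 'm" where
  "minv C a b f = (SOME g. g \<in> Hom C b a \<and> cmp C g f = idm C a \<and> cmp C f g = idm C b)"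

definition dsum :: "('o, 'm, 'r) cat_data \<Rightarrow> 'o \<Rightarrow> 'o list \<Rightarrow> bool" where
  "dsum C s xs \<longleftrightarrow> s \<in> Obj C \<and> set xs \<subseteq> Obj C \<and>
     (\<exists>\<iota> \<pi>. (\<forall>i<length xs. \<iota> i \<in> Hom C (xs ! i) s \<and> \<pi> i \<in> Hom C s (xs ! i)) \<and>
       (\<forall>i<length xs. \<forall>j<length xs. cmp C (\<pi> i) (\<iota> j) =
           (if i = j then idm C (xs ! i) else mzero C (xs ! j) (xs ! i))) \<and>
       foldr (\<lambda>i acc. madd C (cmp C (\<iota> i) (\<pi> i)) acc) [0..<length xs] (mzero C s s)
         = idm C s)"

definition mono :: "('o, 'm, 'r) cat_data \<Rightarrow> 'o \<Rightarrow> 'o \<Rightarrow> 'm \<Rightarrow> bool" where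
  "mono C a s f \<longleftrightarrow> f \<in> Hom C a s \<and>
     (\<forall>c\<in>Obj C. \<forall>g\<in>Hom C c a. \<forall>h\<in>Hom C c a. cmp C f g = cmp C f h \<longrightarrow> g = h)"

definition simple :: "('o, 'm, 'r) cat_data \<Rightarrow> 'o \<Rightarrow> bool" where
  "simple C s \<longleftrightarrow> s \<in> Obj C \<and> idm C s \<noteq> mzero C s s \<and>
     (\<forall>a\<in>Obj C. \<forall>f. mono C a s f \<longrightarrow> idm C a = mzero C a a \<or> is_iso C a s f)"

definition monoidal :: "('o, 'm, 'r::field) cat_data \<Rightarrow> bool" where
  "monoidal C \<longleftrightarrow>
     unitob C \<in> Obj C \<and>
     (\<forall>a\<in>Obj C. \<forall>b\<in>Obj C. tens C a b \<in> Obj C) \<and>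
     (\<forall>a\<in>Obj C. \<forall>b\<in>Obj C. \<forall>c\<in>Obj C. \<forall>d\<in>Obj C. \<forall>f\<in>Hom C a b. \<forall>g\<in>Hom C c d.
         tensm C f g \<in> Hom C (tens C a c) (tens C b d)) \<and>
     (\<forall>a\<in>Obj C. \<forall>b\<in>Obj C. \<forall>c\<in>Obj C. \<forall>a'\<in>Obj C. \<forall>b'\<in>Obj C. \<forall>c'\<in>Obj C.
        \<forall>f\<in>Hom C a b. \<forall>f'\<in>Hom C b c. \<forall>g\<in>Hom C a' b'. \<forall>g'\<in>Hom C b' c'.
         tensm C (cmp C f' f) (cmp C g' g) = cmp C (tensm C f' g') (tensm C f g)) \<and>
     (\<forall>a\<in>Obj C. \<forall>b\<in>Obj C. tensm C (idm C a) (idm C b) = idm C (tens C a b)) \<and>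
     (\<forall>a\<in>Obj C. \<forall>b\<in>Obj C. \<forall>c\<in>Obj C. \<forall>d\<in>Obj C.
        \<forall>f\<in>Hom C a b. \<forall>f'\<in>Hom C a b. \<forall>g\<in>Hom C c d. \<forall>g'\<in>Hom C c d. \<forall>r.
         tensm C (madd C f f') g = madd C (tensm C f g) (tensm C f' g) \<and>
         tensm C f (madd C g g') = madd C (tensm C f g) (tensm C f g') \<and>
         tensm C (msmul C r f) g = msmul C r (tensm C f g) \<and>
         tensm C f (msmul C r g) = msmul C r (tensm C f g)) \<and>
     (\<forall>a\<in>Obj C. \<forall>b\<in>Obj C. \<forall>c\<in>Obj C.
         is_iso C (tens C (tens C a b) c) (tens C a (tens C b c)) (asc C a b c)) \<and>
     (\<forall>a\<in>Obj C. \<forall>b\<in>Obj C. \<forall>c\<in>Obj C. \<forall>a'\<in>Obj C. \<forall>b'\<in>Obj C. \<forall>c'\<in>Obj C.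
        \<forall>f\<in>Hom C a a'. \<forall>g\<in>Hom C b b'. \<forall>h\<in>Hom C c c'.
         cmp C (asc C a' b' c') (tensm C (tensm C f g) h)
           = cmp C (tensm C f (tensm C g h)) (asc C a b c)) \<and>
     (\<forall>a\<in>Obj C. is_iso C (tens C (unitob C) a) a (lu C a) \<and>
                 is_iso C (tens C a (unitob C)) a (ru C a)) \<and>
     (\<forall>a\<in>Obj C. \<forall>b\<in>Obj C. \<forall>f\<in>Hom C a b.
         cmp C (lu C b) (tensm C (idm C (unitob C)) f) = cmp C f (lu C a) \<and>
         cmp C (ru C b) (tensm C f (idm C (unitob C))) = cmp C f (ru C a)) \<and>
     (\<forall>a\<in>Obj C. \<forall>b\<in>Obj C. \<forall>c\<in>Obj C. \<forall>d\<in>Obj C.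
         cmp C (asc C a b (tens C c d)) (asc C (tens C a b) c d)
           = cmp C (tensm C (idm C a) (asc C b c d))
               (cmp C (asc C a (tens C b c) d) (tensm C (asc C a b c) (idm C d)))) \<and>
     (\<forall>a\<in>Obj C. \<forall>b\<in>Obj C.
         cmp C (tensm C (idm C a) (lu C b)) (asc C a (unitob C) b)
           = tensm C (ru C a) (idm C b))"

definition rigid :: "('o, 'm, 'r) cat_data \<Rightarrow> bool" where
  "rigid C \<longleftrightarrow> (\<forall>x\<in>Obj C.
     dual C x \<in> Obj C \<and>
     ev C x \<in> Hom C (tens C (dual C x) x) (unitob C) \<and>
     coev C x \<in> Hom C (unitob C) (tens C x (dual C x)) \<and>
     cmp C (ru C x) (cmp C (tensm C (idm C x) (ev C x))
        (cmp C (asc C x (dual C x) x) (tensm C (coev C x) (idm C x)))) = lu C x \<and>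
     cmp C (lu C (dual C x)) (cmp C (tensm C (ev C x) (idm C (dual C x)))
        (cmp C (minv C (tens C (tens C (dual C x) x) (dual C x))
                       (tens C (dual C x) (tens C x (dual C x)))
                       (asc C (dual C x) x (dual C x)))
           (tensm C (idm C (dual C x)) (coev C x)))) = ru C (dual C x))"

definition near_group_trivial :: "('o, 'm, 'r::field) cat_data \<Rightarrow> 'o \<Rightarrow> nat \<Rightarrow> bool" where
  "near_group_trivial C m k \<longleftrightarrow>
     linear_cat C \<and> monoidal C \<and> rigid C \<and>
     simple C (unitob C) \<and> simple C m \<and>
     (\<forall>s. simple C s \<longrightarrow> iso_obj C s (unitob C) \<or> iso_obj C s m) \<and>
     (\<forall>s. simple C s \<longrightarrow> (\<forall>f\<in>Hom C s s. \<exists>r. f = msmul C r (idm C s))) \<and>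
     Hom C (unitob C) m = {mzero C (unitob C) m} \<and>
     (\<forall>x\<in>Obj C. \<exists>xs. (\<forall>y\<in>set xs. simple C y) \<and> dsum C x xs) \<and>
     dsum C (tens C m m) (unitob C # replicate k m)"

end

theory Submission
  imports "Jordan_Normal_Form.Determinant" Defs
begin

text \<open>
  Let \<open>A\<close> and \<open>B\<close> be the matrices of the associator of \<open>m, m, m\<close> on \<open>Hom(\<epsilon>, -)\<close> and \<open>Hom(m, -)\<close> in tree
  bases, and put \<open>a = det A\<close>, \<open>b = det B\<close>. Taking determinants in the pentagon for \<open>m, m, m, m\<close> on
  \<open>Hom(\<epsilon>, -)\<close> and on \<open>Hom(m, -)\<close>, and keeping track of the signs of the permutations of tree bases at
  \<open>(m \<otimes> m) \<otimes> (m \<otimes> m)\<close>, one gets \<open>b\<^sup>2 = s a\<^sup>k\<close> and \<open>a\<^sup>2 b\<^sup>k = (-s)\<^sup>k\<close>, where \<open>s = (-1)\<close> to the power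
  \<open>k (k - 1) / 2\<close> is the sign of the flip of \<open>V \<otimes> V\<close>, \<open>V = Hom(m, m \<otimes> m)\<close>; for \<open>k\<close> congruent to 2 or 3
  modulo 4, \<open>s = -1\<close>. Two entries of the second pentagon read \<open>A C R = \<beta>\<close> and \<open>C R\<^sup>T = \<beta> A\<^sup>2\<close> for \<open>k \<times> k\<close>
  blocks \<open>C\<close>, \<open>R\<close> of \<open>B\<close> and the scalar entry \<open>\<beta>\<close> of \<open>B\<close> at the unit channel, which rigidity makes
  nonzero. Since \<open>R\<close> and its transpose have the same determinant, \<open>a\<^sup>3 = 1\<close>. Hence \<open>d = b\<^sup>3\<close> satisfies
  \<open>d\<^sup>2 = -1\<close> and \<open>d\<^sup>k = 1\<close>, which is impossible when \<open>2 \<noteq> 0\<close>.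
\<close>

section \<open>Determinants over finite index sets\<close>

text \<open>The two determinant identities alone are consistent: for k = 2, a primitive eighth root
  of unity a and any b with b^2 = -a^2 satisfy both. The relation a^3 = 1 therefore has to come from
  single blocks of the pentagon, and cancelling the power of \<beta> in it is what rigidity is
  needed for. The signs have this origin. The matrix of an associator compares tree bases of two
  different hom-spaces, so its determinant depends on how the labels of the two bases are matched.
  At (m \<otimes> m) \<otimes> (m \<otimes> m) the incoming associator keeps the vertex of the left
  factor inert and the outgoing one that of the right factor. Labels that put the first in block
  form put the second in block form only after the two factors are exchanged. The category is not
  strict. That trees through the unit contribute entries exactly 0 and 1 rests on the compatibility
  of unitors and associators, which has to be derived from pentagon and triangle.\<close>

definition fdet :: "'a set \<Rightarrow> ('a \<Rightarrow> 'a \<Rightarrow> 'r::comm_ring_1) \<Rightarrow> 'r" where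
  "fdet S M = (let h = (SOME h. bij_betw h {0..<card S} S)
     in det (mat (card S) (card S) (\<lambda>(i,j). M (h i) (h j))))"

text \<open>Two enumerations of \<open>S\<close> differ by one permutation acting on rows and
  columns alike, so its sign enters twice and cancels. Determinants thus make sense for unordered
  labels such as trees, provided that rows and columns carry the same labels.\<close>

lemma fdet_enum:
  assumes h: "bij_betw h {0..<n} S"
  shows "fdet S M = det (mat n n (\<lambda>(i,j). M (h i) (h j)))"
proof -
  have fin: "finite S" and card: "card S = n"
    using h bij_betw_finite[OF h] bij_betw_same_card[OF h] by auto
  define g where "g = (SOME h. bij_betw h {0..<card S} S)"
  have g: "bij_betw g {0..<n} S"
    unfolding g_def card[symmetric] by (rule someI_ex[OF ex_bij_betw_nat_finite[OF fin]])
  define q where "q = inv_into {0..<n} h \<circ> g"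
  have q: "bij_betw q {0..<n} {0..<n}"
    unfolding q_def by (rule bij_betw_trans[OF g bij_betw_inv_into[OF h]])
  define p where "p i = (if i < n then q i else i)" for i
  have p: "p permutes {0..<n}"
    using bij_betw_cong[of "{0..<n}" p q] q by (intro bij_imp_permutes) (auto simp: p_def)
  have hp: "h (p i) = g i" if "i < n" for i
    using that h g bij_betwE[OF g] by (auto simp: p_def q_def bij_betw_def f_inv_into_f)
  have pn: "p i < n" if "i < n" for i
    using permutes_in_image[OF p, of i] that by simp
  let ?A = "mat n n (\<lambda>(i,j). M (h i) (h j))"
  let ?B = "mat n n (\<lambda>(i,j). M (h (p i)) (h j))"
  let ?D = "mat n n (\<lambda>(i,j). M (h (p i)) (h (p j)))"
  have "mat n n (\<lambda>(i,j). ?A $$ (p i, j)) = ?B"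
    by (rule eq_matI) (auto simp: pn)
  then have 1: "det ?B = signof p * det ?A"
    using det_permute_rows[of ?A n p] p by simp
  have "mat n n (\<lambda>(i,j). ?B\<^sup>T $$ (p i, j)) = ?D\<^sup>T"
    by (rule eq_matI) (auto simp: pn)
  then have "det (?D\<^sup>T) = signof p * det (?B\<^sup>T)"
    using det_permute_rows[of "?B\<^sup>T" n p] p by simp
  then have "det ?D = signof p * det ?B"
    by (simp add: det_transpose[of _ n])
  with 1 have "det ?D = (signof p * signof p) * det ?A" by simp
  moreover have "signof p * signof p = (1::'b)" by (simp add: sign_def)
  moreover have "fdet S M = det ?D"
    unfolding fdet_def Let_def g_def[symmetric] unfolding card
    by (rule arg_cong[where f=det], rule eq_matI) (auto simp: hp)
  ultimately show ?thesis by simp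
qed

lemma fdet_cong:
  assumes "finite S" "\<And>i j. i \<in> S \<Longrightarrow> j \<in> S \<Longrightarrow> M i j = N i j"
  shows "fdet S M = fdet S N"
proof -
  obtain h where h: "bij_betw h {0..<card S} S" using ex_bij_betw_nat_finite[OF assms(1)] by auto
  have "h i \<in> S" if "i < card S" for i using bij_betwE[OF h] that by auto
  then show ?thesis unfolding fdet_enum[OF h]
    by (intro arg_cong[where f=det] eq_matI) (auto simp: assms)
qed

lemma fdet_mult:
  assumes "finite S"
  shows "fdet S (\<lambda>i j. \<Sum>l\<in>S. M i l * N l j) = fdet S M * fdet S N"
proof -
  obtain h where h: "bij_betw h {0..<card S} S" using ex_bij_betw_nat_finite[OF assms(1)] by auto
  let ?n = "card S"
  have "mat ?n ?n (\<lambda>(i,j). \<Sum>l\<in>S. M (h i) l * N l (h j))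
     = mat ?n ?n (\<lambda>(i,j). M (h i) (h j)) * mat ?n ?n (\<lambda>(i,j). N (h i) (h j))"
    by (rule eq_matI) (auto simp: scalar_prod_def sum.reindex_bij_betw[OF h, symmetric])
  then show ?thesis unfolding fdet_enum[OF h]
    by (simp add: det_mult[of _ ?n])
qed

lemma fdet_transpose:
  assumes "finite S"
  shows "fdet S (\<lambda>i j. M j i) = fdet S M"
proof -
  obtain h where h: "bij_betw h {0..<card S} S" using ex_bij_betw_nat_finite[OF assms(1)] by auto
  let ?A = "mat (card S) (card S) (\<lambda>(i,j). M (h i) (h j))"
  have "mat (card S) (card S) (\<lambda>(i,j). M (h j) (h i)) = ?A\<^sup>T"
    by (rule eq_matI) auto
  then show ?thesis unfolding fdet_enum[OF h] using det_transpose[of ?A "card S"] by simp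
qed

lemma fdet_reindex:
  assumes "finite S" "inj_on f S"
  shows "fdet (f ` S) M = fdet S (\<lambda>i j. M (f i) (f j))"
proof -
  obtain h where h: "bij_betw h {0..<card S} S" using ex_bij_betw_nat_finite[OF assms(1)] by auto
  have "bij_betw (f \<circ> h) {0..<card S} (f ` S)"
    using assms(2) by (intro bij_betw_trans[OF h]) (auto simp: bij_betw_def)
  then show ?thesis using h by (simp add: fdet_enum)
qed

text \<open>Listing \<open>S\<close> before \<open>T\<close> moves the vanishing entries to the
  upper right block.\<close>

lemma fdet_Un_disjoint:
  fixes M :: "'a \<Rightarrow> 'a \<Rightarrow> 'r::idom"
  assumes S: "finite S" and T: "finite T" and ST: "S \<inter> T = {}"
    and z: "\<And>i j. i \<in> S \<Longrightarrow> j \<in> T \<Longrightarrow> M i j = 0"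
  shows "fdet (S \<union> T) M = fdet S M * fdet T M"
proof -
  obtain g where g: "bij_betw g {0..<card S} S" using ex_bij_betw_nat_finite[OF S] by auto
  obtain h where h: "bij_betw h {0..<card T} T" using ex_bij_betw_nat_finite[OF T] by auto
  let ?n = "card S" and ?m = "card T"
  define u where "u i = (if i < ?n then g i else h (i - ?n))" for i
  have u1: "bij_betw u {0..<?n} S"
    using g by (subst bij_betw_cong[where g=g]) (auto simp: u_def)
  have "bij_betw (\<lambda>i. i - ?n) {?n..<?n+?m} {0..<?m}"
    by (rule bij_betw_byWitness[where f'="\<lambda>i. i + ?n"]) auto
  from bij_betw_trans[OF this h] have u2: "bij_betw u {?n..<?n+?m} T"
    by (subst bij_betw_cong[where g="h \<circ> (\<lambda>i. i - ?n)"]) (auto simp: u_def)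
  have "{0..<?n+?m} = {0..<?n} \<union> {?n..<?n+?m}" by auto
  with bij_betw_combine[OF u1 u2 ST] have u: "bij_betw u {0..<?n+?m} (S \<union> T)" by simp
  let ?A = "mat ?n ?n (\<lambda>(i,j). M (g i) (g j))"
  let ?D = "mat ?m ?m (\<lambda>(i,j). M (h i) (h j))"
  let ?E = "mat ?m ?n (\<lambda>(i,j). M (h i) (g j))"
  have "M (g i) (h j) = 0" if "i < ?n" "j < ?m" for i j
    using z bij_betwE[OF g] bij_betwE[OF h] that by auto
  then have "mat (?n+?m) (?n+?m) (\<lambda>(i,j). M (u i) (u j)) = four_block_mat ?A (0\<^sub>m ?n ?m) ?E ?D"
    by (intro eq_matI) (auto simp: u_def)
  then show ?thesis unfolding fdet_enum[OF u] fdet_enum[OF g] fdet_enum[OF h]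
    by (simp add: det_four_block_mat_upper_right_zero[of _ ?n _ ?m])
qed

lemma fdet_empty [simp]: "fdet {} M = 1"
  using fdet_enum[of undefined 0 "{}"] by (simp add: bij_betw_def)

text \<open>\<open>\<phi>\<close> colours the labels, and each colour is a diagonal block. With an
  inert tensor index as colour this gives determinants of matrices of the form id \<otimes>
  A.\<close>

lemma fdet_blocks:
  fixes M :: "'a \<Rightarrow> 'a \<Rightarrow> 'r::idom"
  assumes "finite K" and S: "finite S" and "\<phi> ` S \<subseteq> K"
    and z: "\<And>i j. i \<in> S \<Longrightarrow> j \<in> S \<Longrightarrow> \<phi> i \<noteq> \<phi> j \<Longrightarrow> M i j = 0"
  shows "fdet S M = (\<Prod>\<kappa>\<in>K. fdet {i\<in>S. \<phi> i = \<kappa>} M)"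
  using assms
proof (induction K arbitrary: S rule: finite_induct)
  case empty
  then show ?case by simp
next
  case (insert \<kappa> K)
  let ?S1 = "{i\<in>S. \<phi> i = \<kappa>}" and ?S2 = "{i\<in>S. \<phi> i \<noteq> \<kappa>}"
  have "fdet S M = fdet (?S1 \<union> ?S2) M" by (rule arg_cong[where f="\<lambda>S. fdet S M"]) auto
  also have "\<dots> = fdet ?S1 M * fdet ?S2 M"
    using insert.prems by (intro fdet_Un_disjoint) auto
  also have "fdet ?S2 M = (\<Prod>\<kappa>'\<in>K. fdet {i\<in>?S2. \<phi> i = \<kappa>'} M)"
    using insert.prems by (intro insert.IH) auto
  also have "\<dots> = (\<Prod>\<kappa>'\<in>K. fdet {i\<in>S. \<phi> i = \<kappa>'} M)"
    using insert.hyps by (intro prod.cong refl arg_cong[where f="\<lambda>S. fdet S M"]) auto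
  finally show ?case using insert.hyps by simp
qed

lemma fdet_singleton [simp]: "fdet {x} M = M x x"
proof -
  have "bij_betw (\<lambda>_. x) {0..<1::nat} {x}" by (auto simp: bij_betw_def)
  from fdet_enum[OF this] show ?thesis by (simp add: det_single)
qed

lemma fdet_diag:
  fixes d :: "'a \<Rightarrow> 'r::idom"
  assumes "finite S"
  shows "fdet S (\<lambda>i j. if i = j then d i else 0) = prod d S"
proof -
  have "{i \<in> S. i = \<kappa>} = (if \<kappa> \<in> S then {\<kappa>} else {})" for \<kappa> by auto
  then show ?thesis
    by (subst fdet_blocks[where \<phi>="\<lambda>x. x" and K=S]) (auto simp: assms intro!: prod.cong)
qed

lemma fdet_swap:
  assumes "x \<noteq> y"
  shows "fdet {x, y} (\<lambda>i j. if i = (if j = x then y else x) then 1 else 0) = (-1 :: 'r::idom)"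
proof -
  have "bij_betw (\<lambda>i. if i = 0 then x else y) {0..<2::nat} {x, y}"
    using assms by (auto simp: bij_betw_def inj_on_def numeral_2_eq_2 atLeast0_lessThan_Suc)
  note fdet_enum[OF this, of "\<lambda>i j. if i = (if j = x then y else x) then 1 else 0 :: 'r"]
  also have "mat 2 2 (\<lambda>(i,j). if (if i = 0 then x else y) =
      (if (if j = 0 then x else y) = x then y else x) then 1 else 0 :: 'r) = swaprows_mat 2 0 1"
    using assms by (intro eq_matI) (auto simp: numeral_2_eq_2 less_Suc_eq)
  finally show ?thesis by (simp add: det_swaprows_mat)
qed

text \<open>Removing the orbit of one element splits off a block: a fixed point contributes 1, an
  orbit of two elements contributes -1. The sign is then found by counting moved labels.\<close>

lemma fdet_involution:
  assumes "finite S" and "\<And>x. x \<in> S \<Longrightarrow> \<sigma> x \<in> S \<and> \<sigma> (\<sigma> x) = x"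
  shows "fdet S (\<lambda>i j. if i = \<sigma> j then 1 else 0) = (-1 :: 'r::idom) ^ (card {x\<in>S. \<sigma> x \<noteq> x} div 2)"
  using assms
proof (induction "card S" arbitrary: S rule: less_induct)
  case less
  let ?M = "\<lambda>i j. if i = \<sigma> j then 1 else 0 :: 'r"
  show ?case
  proof (cases "S = {}")
    case False
    then obtain x where x: "x \<in> S" by auto
    let ?T = "{x, \<sigma> x}" and ?S = "S - {x, \<sigma> x}"
    have inv: "\<sigma> y \<in> ?S" if "y \<in> ?S" for y
      using less.prems(2)[of y] less.prems(2)[OF x] that x by auto
    have T: "?T \<subseteq> S" using x less.prems(2) by auto
    have dec: "card ?S < card S" using x less.prems by (intro psubset_card_mono) auto
    have IH: "fdet ?S ?M = (-1) ^ (card {y\<in>?S. \<sigma> y \<noteq> y} div 2)"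
      using less.prems inv by (intro less.hyps dec) auto
    have "fdet S ?M = fdet (?T \<union> ?S) ?M"
      using T by (intro arg_cong[where f="\<lambda>S. fdet S ?M"]) auto
    also have "\<dots> = fdet ?T ?M * fdet ?S ?M"
      using less.prems(1) inv by (intro fdet_Un_disjoint) auto
    finally have eq: "fdet S ?M = fdet ?T ?M * fdet ?S ?M" .
    show ?thesis
    proof (cases "\<sigma> x = x")
      case True
      then have "{y\<in>?S. \<sigma> y \<noteq> y} = {y\<in>S. \<sigma> y \<noteq> y}" by auto
      with eq IH True show ?thesis by simp
    next
      case False
      then have "fdet ?T ?M = -1"
        using fdet_swap[of x "\<sigma> x", where ?'r='r] less.prems(2)[OF x]
        by (subst fdet_cong[where N="\<lambda>i j. if i = (if j = x then \<sigma> x else x) then 1 else 0"]) auto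
      moreover have "{y\<in>S. \<sigma> y \<noteq> y} = insert x (insert (\<sigma> x) {y\<in>?S. \<sigma> y \<noteq> y})"
        using False T less.prems(2)[OF x] by auto
      then have "card {y\<in>S. \<sigma> y \<noteq> y} = card {y\<in>?S. \<sigma> y \<noteq> y} + 2"
        using False less.prems(1) by simp
      ultimately show ?thesis using eq IH by simp
    qed
  qed simp
qed

section \<open>The matrix equations\<close>

definition mmul :: "'a set \<Rightarrow> ('a \<Rightarrow> 'a \<Rightarrow> 'r::comm_ring_1) \<Rightarrow> ('a \<Rightarrow> 'a \<Rightarrow> 'r) \<Rightarrow> 'a \<Rightarrow> 'a \<Rightarrow> 'r" where
  "mmul S M N i j = (\<Sum>l\<in>S. M i l * N l j)"

lemma fdet_mmul: "finite S \<Longrightarrow> fdet S (mmul S M N) = fdet S M * fdet S N"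
  unfolding mmul_def[abs_def] by (rule fdet_mult)

lemma fdet_permute_columns:
  fixes M :: "'a \<Rightarrow> 'a \<Rightarrow> 'r::idom"
  assumes S: "finite S" and \<sigma>: "\<And>x. x \<in> S \<Longrightarrow> \<sigma> x \<in> S \<and> \<sigma> (\<sigma> x) = x"
  shows "fdet S (\<lambda>i j. M i (\<sigma> j)) = fdet S M * (-1) ^ (card {x\<in>S. \<sigma> x \<noteq> x} div 2)"
proof -
  have "fdet S (\<lambda>i j. M i (\<sigma> j)) = fdet S (mmul S M (\<lambda>i j. if i = \<sigma> j then 1 else 0))"
    using \<sigma> by (intro fdet_cong S) (simp add: mmul_def S if_distrib cong: if_cong)
  then show ?thesis using fdet_involution[where 'r='r, OF S \<sigma>] by (simp add: fdet_mmul S)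
qed

text \<open>
  Index sets for the tree bases. Write \<open>V = Hom(m, m \<otimes> m)\<close>, of dimension \<open>k\<close>. Then \<open>Hom(m, m\<^sup>3)\<close> is
  \<open>1 \<oplus> V\<^sup>2\<close>, indexed by \<open>ixs k\<close> with \<open>None\<close> for the tree through the unit object, and \<open>Hom(m, m\<^sup>4)\<close> is
  \<open>(1 \<oplus> V\<^sup>2) \<otimes> V \<oplus> V\<close>, indexed by \<open>jxs k\<close>; the map \<open>enc\<close> identifies \<open>V \<otimes> (1 \<oplus> V\<^sup>2)\<close> with the
  complement of \<open>1 \<otimes> V\<close> in the latter.
\<close>

type_synonym ix = "(nat \<times> nat) option"

definition ixs :: "nat \<Rightarrow> ix set" where
  "ixs k = insert None (Some ` ({..<k} \<times> {..<k}))"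

definition jxs :: "nat \<Rightarrow> (ix \<times> nat + nat) set" where
  "jxs k = (ixs k \<times> {..<k}) <+> {..<k}"

text \<open>The matrix of 1 \<oplus> (id \<otimes> A) on 1 \<oplus> V \<otimes> V: the first index
  is an inert vertex. The entry 1 at \<open>None\<close> reflects unit coherence.\<close>

fun spread :: "(nat \<Rightarrow> nat \<Rightarrow> 'r::comm_ring_1) \<Rightarrow> ix \<Rightarrow> ix \<Rightarrow> 'r" where
  "spread A None None = 1"
| "spread A (Some (i, l)) (Some (i', j)) = (if i = i' then A l j else 0)"
| "spread A _ _ = 0"

text \<open>Exchange of the two factors of (m \<otimes> m) \<otimes> (m \<otimes> m) on labels of
  trees with root in the unit.\<close>

fun flip2 :: "ix \<Rightarrow> ix" where
  "flip2 None = None"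
| "flip2 (Some (i, j)) = Some (j, i)"

text \<open>The associator tensored with the identity of \<open>m\<close>. In
  \<open>Inl (b, h)\<close> the vertex \<open>h\<close> at the root is inert and the subtree
  \<open>b\<close> is transformed by \<open>B\<close>; in \<open>Inr i\<close> the three-leaf
  subtree starts at the unit and is transformed by \<open>A\<close>.\<close>

fun outer :: "(nat \<Rightarrow> nat \<Rightarrow> 'r::comm_ring_1) \<Rightarrow> (ix \<Rightarrow> ix \<Rightarrow> 'r) \<Rightarrow> ix \<times> nat + nat \<Rightarrow> ix \<times> nat + nat \<Rightarrow> 'r" where
  "outer A B (Inl (a, h)) (Inl (b, h')) = (if h = h' then B a b else 0)"
| "outer A B (Inr j) (Inr i) = A j i"
| "outer A B _ _ = 0"

fun enc :: "nat \<Rightarrow> ix \<Rightarrow> ix \<times> nat + nat" where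
  "enc i None = Inr i"
| "enc i (Some (p, q)) = Inl (Some (i, p), q)"

text \<open>Regroups a label by the vertex nearest to the leaves: \<open>Inl h\<close> if that
  vertex is the unit, otherwise \<open>Inr (i, b)\<close> with vertex \<open>i\<close> and the
  remaining three-leaf tree \<open>b\<close>.\<close>

fun dec :: "ix \<times> nat + nat \<Rightarrow> nat + nat \<times> ix" where
  "dec (Inl (None, h)) = Inl h"
| "dec (Inl (Some (i, p), q)) = Inr (i, Some (p, q))"
| "dec (Inr i) = Inr (i, None)"

text \<open>The matrix of an associator with m \<otimes> m in one of its three slots. A unit vertex
  in that slot passes with coefficient 1; a vertex \<open>i\<close> is inert and leaves the
  associator of \<open>m\<close>, \<open>m\<close>, \<open>m\<close>, hence
  \<open>B\<close>.\<close>

definition inner :: "(ix \<Rightarrow> ix \<Rightarrow> 'r::comm_ring_1) \<Rightarrow> ix \<times> nat + nat \<Rightarrow> ix \<times> nat + nat \<Rightarrow> 'r" where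
  "inner B u v = (case (dec u, dec v) of
      (Inl h, Inl h') \<Rightarrow> if h = h' then 1 else 0
    | (Inr (i, a), Inr (j, b)) \<Rightarrow> if i = j then B a b else 0
    | _ \<Rightarrow> 0)"

text \<open>Exchange of the two factors of (m \<otimes> m) \<otimes> (m \<otimes> m) on labels of
  trees with root in \<open>m\<close>: the unit moves from the left factor to the right one, two
  proper vertices trade places, the root vertex stays.\<close>

fun flip3 :: "ix \<times> nat + nat \<Rightarrow> ix \<times> nat + nat" where
  "flip3 (Inl (None, h)) = Inr h"
| "flip3 (Inl (Some (i, p), q)) = Inl (Some (p, i), q)"
| "flip3 (Inr i) = Inl (None, i)"

lemma finite_ixs [simp]: "finite (ixs k)" and finite_jxs [simp]: "finite (jxs k)"
  by (auto simp: ixs_def jxs_def)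

lemma in_ixs [simp]: "None \<in> ixs k" "Some (i, j) \<in> ixs k \<longleftrightarrow> i < k \<and> j < k"
  by (auto simp: ixs_def)

lemma in_jxs [simp]: "Inl (b, h) \<in> jxs k \<longleftrightarrow> b \<in> ixs k \<and> h < k" "Inr i \<in> jxs k \<longleftrightarrow> i < k"
  by (auto simp: jxs_def)

lemma dec_enc [simp]: "dec (enc i b) = Inr (i, b)"
  by (cases "(i, b)" rule: enc.cases) auto

lemma inj_enc: "inj_on (enc i) S"
  by (rule inj_on_inverseI[where g="\<lambda>u. case dec u of Inr (i, b) \<Rightarrow> b"]) simp

lemma dec_eq_Inr: "dec u = Inr (i, b) \<longleftrightarrow> u = enc i b"
  by (cases u rule: dec.cases; cases b) auto

lemma dec_eq_Inl: "dec u = Inl h \<longleftrightarrow> u = Inl (None, h)"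
  by (cases u rule: dec.cases) auto

lemma enc_in_jxs [simp]: "enc i b \<in> jxs k \<longleftrightarrow> i < k \<and> b \<in> ixs k"
  by (cases "(i, b)" rule: enc.cases) (auto simp: jxs_def ixs_def)

lemma fdet_spread:
  fixes A :: "nat \<Rightarrow> nat \<Rightarrow> 'r::idom"
  shows "fdet (ixs k) (spread A) = fdet {..<k} A ^ k"
proof -
  let ?\<phi> = "map_option fst :: ix \<Rightarrow> nat option"
  have "fdet (ixs k) (spread A) = (\<Prod>\<kappa>\<in>insert None (Some ` {..<k}). fdet {i\<in>ixs k. ?\<phi> i = \<kappa>} (spread A))"
    by (rule fdet_blocks) (auto simp: ixs_def elim!: spread.elims)
  also have "\<dots> = fdet {i\<in>ixs k. ?\<phi> i = None} (spread A) * (\<Prod>i<k. fdet {u\<in>ixs k. ?\<phi> u = Some i} (spread A))"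
    by (subst prod.insert) (auto simp: prod.reindex)
  also have "{i\<in>ixs k. ?\<phi> i = None} = {None}" by (auto simp: ixs_def)
  also have "(\<Prod>i<k. fdet {u\<in>ixs k. ?\<phi> u = Some i} (spread A)) = (\<Prod>i<k. fdet {..<k} A)"
  proof (rule prod.cong[OF refl])
    fix i assume i: "i \<in> {..<k}"
    then have "{u\<in>ixs k. ?\<phi> u = Some i} = (\<lambda>l. Some (i, l)) ` {..<k}" by (auto simp: ixs_def)
    then show "fdet {u\<in>ixs k. ?\<phi> u = Some i} (spread A) = fdet {..<k} A"
      by (simp add: fdet_reindex inj_on_def)
  qed
  finally show ?thesis by simp
qed

lemma fdet_outer:
  fixes A :: "nat \<Rightarrow> nat \<Rightarrow> 'r::idom"
  shows "fdet (jxs k) (outer A B) = fdet (ixs k) B ^ k * fdet {..<k} A"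
proof -
  have "fdet (jxs k) (outer A B) = fdet (Inl ` (ixs k \<times> {..<k})) (outer A B) * fdet (Inr ` {..<k}) (outer A B)"
    unfolding jxs_def Plus_def by (rule fdet_Un_disjoint) auto
  also have "fdet (Inr ` {..<k}) (outer A B) = fdet {..<k} A"
    by (simp add: fdet_reindex)
  also have "fdet (Inl ` (ixs k \<times> {..<k})) (outer A B) =
      fdet (ixs k \<times> {..<k}) (\<lambda>u v. outer A B (Inl u) (Inl v))"
    by (simp add: fdet_reindex)
  also have "\<dots> = (\<Prod>h<k. fdet {u \<in> ixs k \<times> {..<k}. snd u = h} (\<lambda>u v. outer A B (Inl u) (Inl v)))"
    by (rule fdet_blocks) auto
  also have "\<dots> = (\<Prod>h<k. fdet (ixs k) B)"
  proof (rule prod.cong[OF refl])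
    fix h assume "h \<in> {..<k}"
    then have "{u \<in> ixs k \<times> {..<k}. snd u = h} = (\<lambda>b. (b, h)) ` ixs k" by auto
    then show "fdet {u \<in> ixs k \<times> {..<k}. snd u = h} (\<lambda>u v. outer A B (Inl u) (Inl v)) = fdet (ixs k) B"
      by (simp add: fdet_reindex inj_on_def)
  qed
  finally show ?thesis by simp
qed

text \<open>The colour keeps each unit label apart, a block of size one, and collects all labels
  with the same inert vertex, a copy of \<open>B\<close>.\<close>

lemma fdet_inner:
  fixes B :: "ix \<Rightarrow> ix \<Rightarrow> 'r::idom"
  shows "fdet (jxs k) (inner B) = fdet (ixs k) B ^ k"
proof -
  let ?\<phi> = "\<lambda>u. map_sum id fst (dec u)"
  have "fdet (jxs k) (inner B) = (\<Prod>\<kappa>\<in>{..<k} <+> {..<k}. fdet {u\<in>jxs k. ?\<phi> u = \<kappa>} (inner B))"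
  proof (rule fdet_blocks)
    show "?\<phi> ` jxs k \<subseteq> {..<k} <+> {..<k}"
    proof (rule image_subsetI)
      fix u assume "u \<in> jxs k"
      then show "?\<phi> u \<in> {..<k} <+> {..<k}" by (cases u rule: dec.cases) auto
    qed
    show "inner B u v = 0" if "?\<phi> u \<noteq> ?\<phi> v" for u v
      using that by (cases "dec u"; cases "dec v") (simp_all add: inner_def split_def)
  qed simp_all
  also have "\<dots> = (\<Prod>h<k. fdet {u\<in>jxs k. ?\<phi> u = Inl h} (inner B)) * (\<Prod>i<k. fdet {u\<in>jxs k. ?\<phi> u = Inr i} (inner B))"
    by (simp add: prod.Plus)
  also have "(\<Prod>h<k. fdet {u\<in>jxs k. ?\<phi> u = Inl h} (inner B)) = (\<Prod>h<k. 1)"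
  proof (rule prod.cong[OF refl])
    fix h assume h: "h \<in> {..<k}"
    have "?\<phi> u = Inl h \<longleftrightarrow> u = Inl (None, h)" for u by (cases u rule: dec.cases) simp_all
    then have "{u\<in>jxs k. ?\<phi> u = Inl h} = jxs k \<inter> {Inl (None, h)}" by blast
    also have "\<dots> = {Inl (None, h)}" using h by simp
    finally have "{u\<in>jxs k. ?\<phi> u = Inl h} = {Inl (None, h)}" .
    then show "fdet {u\<in>jxs k. ?\<phi> u = Inl h} (inner B) = 1" by (simp add: inner_def)
  qed
  also have "(\<Prod>i<k. fdet {u\<in>jxs k. ?\<phi> u = Inr i} (inner B)) = (\<Prod>i<k. fdet (ixs k) B)"
  proof (rule prod.cong[OF refl])
    fix i assume i: "i \<in> {..<k}"
    have "{u\<in>jxs k. ?\<phi> u = Inr i} = enc i ` ixs k"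
    proof (intro equalityI subsetI)
      fix u assume "u \<in> {u\<in>jxs k. ?\<phi> u = Inr i}"
      then have u: "u \<in> jxs k" "?\<phi> u = Inr i" by simp_all
      then obtain b where "dec u = Inr (i, b)" by (cases "dec u") (simp, metis map_sum.simps(2) prod.collapse sum.inject(2))
      then have "u = enc i b" by (simp only: dec_eq_Inr)
      with u(1) have "b \<in> ixs k" by simp
      then show "u \<in> enc i ` ixs k" using \<open>u = enc i b\<close> by (rule rev_image_eqI)
    qed (use i in auto)
    then show "fdet {u\<in>jxs k. ?\<phi> u = Inr i} (inner B) = fdet (ixs k) B"
      by (simp add: fdet_reindex[OF _ inj_enc] inner_def)
  qed
  finally show ?thesis by simp
qed

lemma card_off_diagonal: "card {x \<in> {..<k} \<times> {..<k}. fst x \<noteq> snd x} = k * (k - 1)" for k :: nat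
proof -
  have "{x \<in> {..<k} \<times> {..<k}. fst x \<noteq> snd x} = {..<k} \<times> {..<k} - (\<lambda>i. (i, i)) ` {..<k}" by auto
  also have "card \<dots> = k * k - k"
    by (subst card_Diff_subset) (auto simp: card_image inj_on_def)
  finally show ?thesis by (simp add: diff_mult_distrib2)
qed

lemma card_moved_flip2: "card {u \<in> ixs k. flip2 u \<noteq> u} = k * (k - 1)"
proof -
  have "{u \<in> ixs k. flip2 u \<noteq> u} = Some ` {x \<in> {..<k} \<times> {..<k}. fst x \<noteq> snd x}"
    by (auto simp: ixs_def)
  then show ?thesis by (simp add: card_image card_off_diagonal)
qed

text \<open>The summand \<open>2 * k\<close> counts the labels with the unit in one of the two
  factors; the rest is \<open>k\<close> copies, one for each root vertex, of the flip of V \<otimes>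
  V.\<close>

lemma card_moved_flip3: "card {u \<in> jxs k. flip3 u \<noteq> u} = 2 * k + k * (k - 1) * k"
proof -
  let ?D = "{x \<in> {..<k} \<times> {..<k}. fst x \<noteq> snd x}"
  let ?E = "Inr ` {..<k} \<union> (\<lambda>h. Inl (None, h)) ` {..<k} \<union> (\<lambda>(x, q). Inl (Some x, q)) ` (?D \<times> {..<k}) :: (ix \<times> nat + nat) set"
  have "{u \<in> jxs k. flip3 u \<noteq> u} = ?E"
    by (auto simp: jxs_def ixs_def image_iff)
  also have "card ?E = k + k + card (?D \<times> {..<k})"
    by (subst card_Un_disjoint, simp, simp, force, subst card_Un_disjoint)
      (auto simp: card_image inj_on_def)
  finally show ?thesis by (simp only: card_cartesian_product card_off_diagonal card_lessThan)
qed

lemma flip2_involutive: "u \<in> ixs k \<Longrightarrow> flip2 u \<in> ixs k \<and> flip2 (flip2 u) = u"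
  by (cases u rule: flip2.cases) auto

lemma flip3_involutive: "u \<in> jxs k \<Longrightarrow> flip3 u \<in> jxs k \<and> flip3 (flip3 u) = u"
  by (cases u rule: flip3.cases) auto

section \<open>The contradiction between the two matrix pentagons\<close>

lemma sum_jxs:
  fixes F :: "ix \<times> nat + nat \<Rightarrow> 'r::comm_ring_1"
  shows "sum F (jxs k) = (\<Sum>h<k. F (Inl (None, h))) + (\<Sum>i<k. \<Sum>p<k. \<Sum>q<k. F (Inl (Some (i, p), q)))
    + (\<Sum>i<k. F (Inr i))"
proof -
  have "sum F (jxs k) = (\<Sum>b\<in>ixs k. \<Sum>h<k. F (Inl (b, h))) + (\<Sum>i<k. F (Inr i))"
    unfolding jxs_def by (simp add: sum.Plus sum.cartesian_product)
  also have "(\<Sum>b\<in>ixs k. \<Sum>h<k. F (Inl (b, h))) =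
     (\<Sum>h<k. F (Inl (None, h))) + (\<Sum>x\<in>{..<k}\<times>{..<k}. \<Sum>h<k. F (Inl (Some x, h)))"
    unfolding ixs_def by (subst sum.insert) (auto simp: sum.reindex)
  also have "(\<Sum>x\<in>{..<k}\<times>{..<k}. \<Sum>h<k. F (Inl (Some x, h)))
      = (\<Sum>(i, p)\<in>{..<k}\<times>{..<k}. \<Sum>h<k. F (Inl (Some (i, p), h)))"
    by (rule sum.cong) auto
  also have "\<dots> = (\<Sum>i<k. \<Sum>p<k. \<Sum>h<k. F (Inl (Some (i, p), h)))"
    by (rule sum.cartesian_product[symmetric])
  finally show ?thesis .
qed

lemma odd_triangular:
  fixes k :: nat
  assumes "k mod 4 = 2 \<or> k mod 4 = 3"
  shows "odd (k * (k - 1) div 2)"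
proof -
  define n where "n = k div 4"
  from assms have "k = 4 * n + 2 \<or> k = 4 * n + 3" unfolding n_def by presburger
  then have "k * (k - 1) = 2 * ((2 * n + 1) * (4 * n + 1)) \<or> k * (k - 1) = 2 * ((4 * n + 3) * (2 * n + 1))"
    by (elim disjE) (simp_all add: algebra_simps)
  then have "k * (k - 1) div 2 = (2 * n + 1) * (4 * n + 1) \<or> k * (k - 1) div 2 = (4 * n + 3) * (2 * n + 1)"
    by (elim disjE) (simp_all only: nonzero_mult_div_cancel_left zero_neq_numeral[symmetric] simp_thms refl)
  then show ?thesis by (elim disjE) (simp_all only: even_mult_iff even_add, simp_all)
qed

lemma no_matrix_solution:
  fixes A :: "nat \<Rightarrow> nat \<Rightarrow> 'r::field" and B :: "ix \<Rightarrow> ix \<Rightarrow> 'r"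
  assumes two: "(2::'r) \<noteq> 0" and k: "k mod 4 = 2 \<or> k mod 4 = 3"
    and \<beta>: "B None None \<noteq> 0"
    and E1: "\<And>u v. u \<in> ixs k \<Longrightarrow> v \<in> ixs k \<Longrightarrow>
      mmul (ixs k) B (mmul (ixs k) (spread A) B) u v
      = mmul (ixs k) (\<lambda>u v. spread A u (flip2 v)) (spread A) u v"
    and E2: "\<And>u v. u \<in> jxs k \<Longrightarrow> v \<in> jxs k \<Longrightarrow>
      mmul (jxs k) (outer A B) (mmul (jxs k) (inner B) (outer A B)) u v
      = mmul (jxs k) (\<lambda>u v. inner B u (flip3 v)) (inner B) u v"
  shows False
proof -
  let ?I = "{..<k}"
  define a where "a = fdet ?I A"
  define b where "b = fdet (ixs k) B"
  define \<beta> where "\<beta> = B None None"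
  define c where "c = (\<lambda>i q. B (Some (i, q)) None)"
  define r where "r = (\<lambda>q h. B None (Some (q, h)))"
  \<comment> \<open>The entries of \<open>inner\<close> and \<open>outer\<close> carry conditions
    free of the summation variable; this pulls them out of the sum.\<close>
  have sum_if: "(\<Sum>p\<in>S. if P then f p else 0) = (if P then sum f S else 0)"
    for P S and f :: "nat \<Rightarrow> 'r" by (cases P) simp_all
  \<comment> \<open>Rows \<open>Inr j\<close>, columns \<open>Inl (None, h)\<close>. On the right,
    \<open>inner\<close> fixes the column label and \<open>flip3\<close> sends it to
    \<open>Inr h\<close>, which leaves \<open>\<beta>\<close> on the diagonal.\<close>
  have acr: "mmul ?I A (mmul ?I c r) j h = (if j = h then \<beta> else 0)" if "j < k" "h < k" for j h
  proof -
    have "(\<Sum>i<k. A j i * (\<Sum>p<k. r p h * c i p)) = (if j = h then \<beta> else 0)"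
      using E2[of "Inr j" "Inl (None, h)"] that unfolding c_def r_def \<beta>_def
      by - ((simp add: mmul_def sum_jxs inner_def if_distrib[of "\<lambda>x. x * _"]
          if_distrib[of "\<lambda>x. _ * x"] cong: if_cong), simp only: sum_if, simp, intro impI, simp)
    then show ?thesis by (simp only: mmul_def mult.commute[of "c _ _"])
  qed
  \<comment> \<open>Rows \<open>Inr j\<close>, columns \<open>Inr f\<close>. Now \<open>c\<close>
    and \<open>r\<close> occur on the side of the permutation, and the exchange of the two vertices
    by \<open>flip3\<close> is what transposes \<open>r\<close>.\<close>
  have crt: "mmul ?I c (\<lambda>i j. r j i) j f = mmul ?I A (mmul ?I (\<lambda>i j. if i = j then \<beta> else 0) A) j f"
    if "j < k" "f < k" for j f
  proof -
    have "(\<Sum>i<k. A j i * (\<beta> * A i f)) = (\<Sum>q<k. r f q * c j q)"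
      using E2[of "Inr j" "Inr f"] that unfolding c_def r_def \<beta>_def
      by - ((simp add: mmul_def sum_jxs inner_def if_distrib[of "\<lambda>x. x * _"]
          if_distrib[of "\<lambda>x. _ * x"] cong: if_cong), simp only: sum_if, simp)
    then show ?thesis
      by (simp add: mmul_def mult.commute[of "c _ _"] if_distrib[of "\<lambda>x. x * _"] cong: if_cong)
  qed
  have "a * (fdet ?I c * fdet ?I r) = fdet ?I (mmul ?I A (mmul ?I c r))"
    by (simp add: a_def fdet_mmul)
  also have "\<dots> = fdet ?I (\<lambda>i j. if i = j then \<beta> else 0)"
    by (rule fdet_cong) (auto simp: acr)
  finally have 1: "a * (fdet ?I c * fdet ?I r) = \<beta> ^ k" by (simp add: fdet_diag)
  have "fdet ?I c * fdet ?I r = fdet ?I (mmul ?I c (\<lambda>i j. r j i))"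
    using fdet_transpose[of ?I r] by (simp add: fdet_mmul)
  also have "\<dots> = fdet ?I (mmul ?I A (mmul ?I (\<lambda>i j. if i = j then \<beta> else 0) A))"
    by (rule fdet_cong) (auto simp: crt)
  finally have 2: "fdet ?I c * fdet ?I r = a * \<beta> ^ k * a"
    by (simp add: fdet_mmul fdet_diag a_def)
  from 1 2 have "\<beta> ^ k * a ^ 3 = \<beta> ^ k * 1" by (simp add: power3_eq_cube ac_simps)
  then have a3: "a ^ 3 = 1" using \<beta> by (simp add: \<beta>_def)
  then have a0: "a \<noteq> 0" by auto

  have "b * (a ^ k * b) = fdet (ixs k) (mmul (ixs k) B (mmul (ixs k) (spread A) B))"
    by (simp add: fdet_mmul fdet_spread a_def b_def)
  also have "\<dots> = fdet (ixs k) (mmul (ixs k) (\<lambda>u v. spread A u (flip2 v)) (spread A))"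
    by (rule fdet_cong) (auto simp: E1)
  also have "\<dots> = fdet (ixs k) (\<lambda>u v. spread A u (flip2 v)) * a ^ k"
    by (simp add: fdet_mmul fdet_spread a_def)
  also have "fdet (ixs k) (\<lambda>u v. spread A u (flip2 v)) = a ^ k * (-1) ^ (k * (k - 1) div 2)"
    by (subst fdet_permute_columns) (simp_all add: flip2_involutive fdet_spread a_def card_moved_flip2)
  finally have b2: "b\<^sup>2 = - (a ^ k)"
    using odd_triangular[OF k] a0 by (simp add: power2_eq_square ac_simps)
  then have b0: "b \<noteq> 0" using a0 by auto

  have "even ((2 * k + k * (k - 1) * k) div 2)"
  proof -
    have "even (k * (k - 1))" by (cases "even k") auto
    then obtain t where t: "k * (k - 1) = 2 * t" by (rule evenE)
    then have "odd t" using odd_triangular[OF k] by simp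
    \<comment> \<open>The number of transpositions in \<open>flip3\<close> is
      \<open>k * (t + 1)\<close> with \<open>t\<close> odd, hence even.\<close>
    moreover have "(2 * k + k * (k - 1) * k) div 2 = (2 * (k * (t + 1))) div 2"
      unfolding t by (simp add: algebra_simps)
    ultimately show ?thesis by simp
  qed
  then have sgn: "(-1::'r) ^ ((2 * k + k * (k - 1) * k) div 2) = 1" by simp
  have "b ^ k * a * (b ^ k * (b ^ k * a))
      = fdet (jxs k) (mmul (jxs k) (outer A B) (mmul (jxs k) (inner B) (outer A B)))"
    by (simp add: fdet_mmul fdet_outer fdet_inner a_def b_def)
  also have "\<dots> = fdet (jxs k) (mmul (jxs k) (\<lambda>u v. inner B u (flip3 v)) (inner B))"
    by (rule fdet_cong) (simp_all add: E2)
  also have "\<dots> = fdet (jxs k) (\<lambda>u v. inner B u (flip3 v)) * b ^ k"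
    by (simp add: fdet_mmul fdet_inner b_def)
  also have "fdet (jxs k) (\<lambda>u v. inner B u (flip3 v)) = b ^ k"
    by (subst fdet_permute_columns)
      (simp_all only: flip3_involutive fdet_inner b_def card_moved_flip3 sgn finite_jxs simp_thms mult_1_right)
  finally have ab: "a\<^sup>2 * b ^ k = 1" using b0 by (simp add: power2_eq_square ac_simps)

  \<comment> \<open>Cubing removes \<open>a\<close>: \<open>b\<^sup>3\<close> squares to \<open>-1\<close> and its \<open>k\<close>-th power is \<open>1\<close>.\<close>
  define d where "d = b ^ 3"
  have "d\<^sup>2 = (b\<^sup>2) ^ 3" by (simp add: d_def power_mult[symmetric] mult.commute)
  also have "\<dots> = - ((a ^ 3) ^ k)" by (simp add: b2 power_mult[symmetric] mult.commute)
  finally have d2: "d\<^sup>2 = -1" by (simp add: a3)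
  have "(a\<^sup>2 * b ^ k) ^ 3 = (a ^ 3)\<^sup>2 * d ^ k"
    by (simp add: d_def power_mult_distrib power_mult[symmetric] mult.commute)
  then have dk: "d ^ k = 1" by (simp add: ab a3)
  define n where "n = k div 4"
  have d4: "d ^ (4 * n) = 1"
  proof -
    have "d ^ (4 * n) = (d\<^sup>2)^(2 * n)" by (simp add: power_mult[symmetric])
    then show ?thesis by (simp add: d2)
  qed
  from k have "k = 4 * n + 2 \<or> k = 4 * n + 3" unfolding n_def by presburger
  \<comment> \<open>The factor \<open>d ^ (4 * n)\<close> is 1. For residue 2 this leaves
    \<open>d\<^sup>2 = 1\<close> against \<open>d\<^sup>2 = -1\<close>; for residue 3 it forces
    \<open>d = -1\<close>, whose square is 1.\<close>
  then have "d\<^sup>2 = 1 \<or> d\<^sup>2 * d = 1"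
    using dk d4 by (auto simp: power_add power3_eq_cube power2_eq_square)
  then have "(-1::'r) = 1" 
  proof
    assume "d\<^sup>2 * d = 1"
    then have "d = -1" using d2 by (simp add: minus_equation_iff[of d])
    then show ?thesis using d2 by simp
  qed (use d2 in simp)
  then show False using two by (metis add_neg_numeral_special(7) one_add_one)
qed

section \<open>Linear monoidal categories\<close>

lemma vspace_smul_0:
  assumes V: "vspace V ad z sm" and v: "v \<in> V"
  shows "sm 0 v = z"
proof -
  have sm: "\<forall>c. \<forall>x\<in>V. sm c x \<in> V"
    and assoc: "\<forall>x\<in>V. \<forall>y\<in>V. \<forall>w\<in>V. ad (ad x y) w = ad x (ad y w)"
    and comm: "\<forall>x\<in>V. \<forall>y\<in>V. ad x y = ad y x"
    and zero: "z \<in> V" "\<forall>x\<in>V. ad z x = x"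
    and inv: "\<forall>x\<in>V. \<exists>y\<in>V. ad x y = z"
    and dist: "\<forall>c d. \<forall>x\<in>V. sm (c + d) x = ad (sm c x) (sm d x)"
    using V unfolding vspace_def by - (elim conjE, assumption)+
  have x: "sm 0 v \<in> V" using sm v by blast
  then obtain y where y: "y \<in> V" "ad (sm 0 v) y = z" using inv by blast
  have "ad (sm 0 v) (sm 0 v) = sm 0 v" using dist[rule_format, OF v, of 0 0] by simp
  then have "z = ad (sm 0 v) z" using assoc[rule_format, OF x x y(1)] y by simp
  also have "\<dots> = sm 0 v" using comm[rule_format, OF x zero(1)] zero(2) x by simp
  finally show ?thesis by simp
qed

locale linear_monoidal_category =
  fixes C :: "('o, 'm, 'r::field) cat_data"
  assumes lin: "linear_cat C" and mon: "monoidal C"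
begin

abbreviation comp (infixr "\<cdot>" 70) where "g \<cdot> f \<equiv> cmp C g f"
abbreviation tensor_mor (infixr "\<star>" 75) where "f \<star> g \<equiv> tensm C f g"
abbreviation tensor_obj (infixr "\<diamondop>" 75) where "a \<diamondop> b \<equiv> tens C a b"
abbreviation ident ("\<i>") where "\<i> \<equiv> idm C"
abbreviation E where "E \<equiv> unitob C"
abbreviation assoc ("\<a>") where "\<a> \<equiv> asc C"

section \<open>The axioms as typed rewrite rules; \<open>linN\<close> and \<open>monN\<close> are
  the axiom lists from their N-th conjunct on\<close>

lemmas lin1 = lin[unfolded linear_cat_def]
lemmas lin2 = lin1[THEN conjunct2]
lemmas lin3 = lin2[THEN conjunct2]
lemmas lin4 = lin3[THEN conjunct2]
lemmas lin5 = lin4[THEN conjunct2]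
lemmas lin6 = lin5[THEN conjunct2]
lemmas lin7 = lin6[THEN conjunct2]
lemmas lin8 = lin7[THEN conjunct2]
lemmas lin9 = lin8[THEN conjunct2]
lemmas mon1 = mon[unfolded monoidal_def]
lemmas mon2 = mon1[THEN conjunct2]
lemmas mon3 = mon2[THEN conjunct2]
lemmas mon4 = mon3[THEN conjunct2]
lemmas mon5 = mon4[THEN conjunct2]
lemmas mon6 = mon5[THEN conjunct2]
lemmas mon7 = mon6[THEN conjunct2]
lemmas mon8 = mon7[THEN conjunct2]
lemmas mon9 = mon8[THEN conjunct2]
lemmas mon10 = mon9[THEN conjunct2]
lemmas mon11 = mon10[THEN conjunct2]
lemmas mon12 = mon11[THEN conjunct2]

text \<open>Hom-sets are disjoint, so source and target are functions of the arrow. Membership in a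
  hom-set becomes three facts that the simplifier can compute.\<close>

definition arr :: "'m \<Rightarrow> bool" where "arr f \<longleftrightarrow> (\<exists>a b. f \<in> Hom C a b)"
definition dm :: "'m \<Rightarrow> 'o" where "dm f = (THE a. \<exists>b. f \<in> Hom C a b)"
definition cd :: "'m \<Rightarrow> 'o" where "cd f = (THE b. \<exists>a. f \<in> Hom C a b)"

lemma Hom_unique: "f \<in> Hom C a b \<Longrightarrow> f \<in> Hom C a' b' \<Longrightarrow> a = a' \<and> b = b'"
  using lin2[THEN conjunct1] by blast

lemma Hom_iff: "f \<in> Hom C a b \<longleftrightarrow> arr f \<and> dm f = a \<and> cd f = b"
proof -
  have dm: "dm f = a" if "f \<in> Hom C a b" for a b
    unfolding dm_def by (rule the_equality) (use that Hom_unique in blast)+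
  have cd: "cd f = b" if "f \<in> Hom C a b" for a b
    unfolding cd_def by (rule the_equality) (use that Hom_unique in blast)+
  show ?thesis using dm cd by (auto simp: arr_def)
qed

lemma arr_obj: assumes "arr f" shows "dm f \<in> Obj C" "cd f \<in> Obj C"
proof -
  have "f \<in> Hom C (dm f) (cd f)" using assms by (simp add: Hom_iff)
  moreover have "a \<notin> Obj C \<or> b \<notin> Obj C \<longrightarrow> Hom C a b = {}" for a b
    using lin1[THEN conjunct1] by blast
  ultimately show "dm f \<in> Obj C" "cd f \<in> Obj C" by (metis empty_iff)+
qed

lemma in_Hom: "arr f \<Longrightarrow> f \<in> Hom C (dm f) (cd f)"
  by (simp add: Hom_iff)

lemma ident_arr [simp]: "a \<in> Obj C \<Longrightarrow> arr (\<i> a)" "a \<in> Obj C \<Longrightarrow> dm (\<i> a) = a" "a \<in> Obj C \<Longrightarrow> cd (\<i> a) = a"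
  using lin3[THEN conjunct1, rule_format] unfolding Hom_iff by blast+

lemma comp_arr [simp]:
  assumes "arr f" "arr g" "cd f = dm g"
  shows "arr (g \<cdot> f)" "dm (g \<cdot> f) = dm f" "cd (g \<cdot> f) = cd g"
proof -
  have "g \<cdot> f \<in> Hom C (dm f) (cd g)"
    by (rule lin4[THEN conjunct1, rule_format, of _ "cd f"])
      (use assms in \<open>auto simp: Hom_iff arr_obj\<close>)
  then show "arr (g \<cdot> f)" "dm (g \<cdot> f) = dm f" "cd (g \<cdot> f) = cd g" by (simp_all add: Hom_iff)
qed

lemma comp_assoc [simp]:
  assumes "arr f" "arr g" "arr h" "cd f = dm g" "cd g = dm h"
  shows "(h \<cdot> g) \<cdot> f = h \<cdot> (g \<cdot> f)"
  by (rule lin5[THEN conjunct1, rule_format, of "dm f" "cd f" "cd g" "cd h", symmetric])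
    (use assms in \<open>auto simp: Hom_iff arr_obj\<close>)

lemma ident_comp [simp]:
  assumes "arr f"
  shows "dm f = a \<Longrightarrow> f \<cdot> \<i> a = f" "cd f = a \<Longrightarrow> \<i> a \<cdot> f = f"
  using lin6[THEN conjunct1, rule_format, of "dm f" "cd f" f] assms
  by (auto simp: Hom_iff arr_obj)

lemma vspace_Hom: "a \<in> Obj C \<Longrightarrow> b \<in> Obj C \<Longrightarrow> vspace (Hom C a b) (madd C) (mzero C a b) (msmul C)"
  using lin7[THEN conjunct1] by blast

lemma add_arr [simp]:
  assumes "arr f" "arr g" "dm g = dm f" "cd g = cd f"
  shows "arr (madd C f g)" "dm (madd C f g) = dm f" "cd (madd C f g) = cd f"
proof -
  have "madd C f g \<in> Hom C (dm f) (cd f)"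
    using vspace_Hom[of "dm f" "cd f"] assms arr_obj[of f] in_Hom[of f] in_Hom[of g]
    by (simp add: vspace_def)
  then show "arr (madd C f g)" "dm (madd C f g) = dm f" "cd (madd C f g) = cd f" by (simp_all add: Hom_iff)
qed

lemma smul_arr [simp]:
  assumes "arr f"
  shows "arr (msmul C r f)" "dm (msmul C r f) = dm f" "cd (msmul C r f) = cd f"
proof -
  have "msmul C r f \<in> Hom C (dm f) (cd f)"
    using vspace_Hom[of "dm f" "cd f"] assms arr_obj[of f] in_Hom[of f]
    by (simp add: vspace_def)
  then show "arr (msmul C r f)" "dm (msmul C r f) = dm f" "cd (msmul C r f) = cd f" by (simp_all add: Hom_iff)
qed

lemma zero_arr [simp]:
  assumes "a \<in> Obj C" "b \<in> Obj C"
  shows "arr (mzero C a b)" "dm (mzero C a b) = a" "cd (mzero C a b) = b"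
proof -
  have "mzero C a b \<in> Hom C a b" using vspace_Hom[OF assms] by (simp add: vspace_def)
  then show "arr (mzero C a b)" "dm (mzero C a b) = a" "cd (mzero C a b) = b" by (simp_all add: Hom_iff)
qed

lemma comp_linear:
  assumes "arr f" "arr g" "cd f = dm g"
  shows "g \<cdot> msmul C r f = msmul C r (g \<cdot> f)" "msmul C r g \<cdot> f = msmul C r (g \<cdot> f)"
    "arr f' \<Longrightarrow> dm f' = dm f \<Longrightarrow> cd f' = cd f \<Longrightarrow> g \<cdot> madd C f f' = madd C (g \<cdot> f) (g \<cdot> f')"
    "arr g' \<Longrightarrow> dm g' = dm g \<Longrightarrow> cd g' = cd g \<Longrightarrow> madd C g g' \<cdot> f = madd C (g \<cdot> f) (g' \<cdot> f)"
  using lin9[rule_format, of "dm f" "cd f" "cd g" f _ g]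
    lin9[rule_format, of "dm f" "cd f" "cd g" f f g]
    assms arr_obj[of f] arr_obj[of g]
  by (simp_all add: Hom_iff)

lemma smul_0 [simp]: "arr f \<Longrightarrow> msmul C 0 f = mzero C (dm f) (cd f)"
  using vspace_smul_0[OF vspace_Hom in_Hom] arr_obj by blast

text \<open>A zero arrow is 0 times itself, so compatibility with scalars is enough.\<close>

lemma comp_zero [simp]:
  assumes "arr g" "a \<in> Obj C"
  shows "b = dm g \<Longrightarrow> g \<cdot> mzero C a b = mzero C a (cd g)" "b = cd g \<Longrightarrow> mzero C b a \<cdot> g = mzero C (dm g) a"
proof -
  note [simp] = assms arr_obj[OF assms(1)]
  have "g \<cdot> mzero C a (dm g) = mzero C a (cd g)"
    using comp_linear(1)[of "mzero C a (dm g)" g 0] by simp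
  then show "b = dm g \<Longrightarrow> g \<cdot> mzero C a b = mzero C a (cd g)" by simp
  have "mzero C (cd g) a \<cdot> g = mzero C (dm g) a"
    using comp_linear(2)[of g "mzero C (cd g) a" 0] by simp
  then show "b = cd g \<Longrightarrow> mzero C b a \<cdot> g = mzero C (dm g) a" by simp
qed

lemma tensor_obj_in [simp]: "a \<in> Obj C \<Longrightarrow> b \<in> Obj C \<Longrightarrow> a \<diamondop> b \<in> Obj C"
  and unit_in [simp]: "E \<in> Obj C"
  using mon2[THEN conjunct1] mon1[THEN conjunct1] by blast+

lemma tensor_arr [simp]:
  assumes "arr f" "arr g"
  shows "arr (f \<star> g)" "dm (f \<star> g) = dm f \<diamondop> dm g" "cd (f \<star> g) = cd f \<diamondop> cd g"
proof -
  have "f \<star> g \<in> Hom C (dm f \<diamondop> dm g) (cd f \<diamondop> cd g)"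
    by (rule mon3[THEN conjunct1, rule_format])
      (use assms in \<open>auto simp: Hom_iff arr_obj\<close>)
  then show "arr (f \<star> g)" "dm (f \<star> g) = dm f \<diamondop> dm g" "cd (f \<star> g) = cd f \<diamondop> cd g"
    by (simp_all add: Hom_iff)
qed

lemma interchange:
  assumes "arr f" "arr f'" "cd f = dm f'" "arr g" "arr g'" "cd g = dm g'"
  shows "(f' \<star> g') \<cdot> (f \<star> g) = (f' \<cdot> f) \<star> (g' \<cdot> g)"
  by (rule mon4[THEN conjunct1, rule_format, of "dm f" "cd f" "cd f'" "dm g" "cd g" "cd g'", symmetric])
    (use assms in \<open>auto simp: Hom_iff arr_obj\<close>)

text \<open>Composites are kept bracketed to the right, so two adjacent tensor products usually have
  a tail \<open>t\<close> behind them.\<close>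

lemma interchange_comp:
  assumes "arr f" "arr f'" "cd f = dm f'" "arr g" "arr g'" "cd g = dm g'"
    "arr t" "cd t = dm f \<diamondop> dm g"
  shows "(f' \<star> g') \<cdot> (f \<star> g) \<cdot> t = ((f' \<cdot> f) \<star> (g' \<cdot> g)) \<cdot> t"
  using assms comp_assoc[of t "f \<star> g" "f' \<star> g'"] by (simp add: interchange)

lemma ident_tensor [simp]: "a \<in> Obj C \<Longrightarrow> b \<in> Obj C \<Longrightarrow> \<i> a \<star> \<i> b = \<i> (a \<diamondop> b)"
  using mon5[THEN conjunct1] by blast

lemma tensor_linear:
  assumes "arr f" "arr g"
  shows "f \<star> msmul C r g = msmul C r (f \<star> g)" "msmul C r f \<star> g = msmul C r (f \<star> g)"
    "arr f' \<Longrightarrow> dm f' = dm f \<Longrightarrow> cd f' = cd f \<Longrightarrow> madd C f f' \<star> g = madd C (f \<star> g) (f' \<star> g)"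
    "arr g' \<Longrightarrow> dm g' = dm g \<Longrightarrow> cd g' = cd g \<Longrightarrow> f \<star> madd C g g' = madd C (f \<star> g) (f \<star> g')"
  using mon6[THEN conjunct1, rule_format, of "dm f" "cd f" "dm g" "cd g" f _ g]
    mon6[THEN conjunct1, rule_format, of "dm f" "cd f" "dm g" "cd g" f f g]
    assms arr_obj[of f] arr_obj[of g]
  by (simp_all add: Hom_iff)

lemma tensor_zero [simp]:
  assumes "arr f" "a \<in> Obj C" "b \<in> Obj C"
  shows "f \<star> mzero C a b = mzero C (dm f \<diamondop> a) (cd f \<diamondop> b)"
    "mzero C a b \<star> f = mzero C (a \<diamondop> dm f) (b \<diamondop> cd f)"
  using tensor_linear(1)[of f "mzero C a b" 0] tensor_linear(2)[of "mzero C a b" f 0] assms by simp_all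

definition iso :: "'m \<Rightarrow> bool" where
  "iso f \<longleftrightarrow> arr f \<and> (\<exists>g. arr g \<and> dm g = cd f \<and> cd g = dm f \<and> g \<cdot> f = \<i> (dm f) \<and> f \<cdot> g = \<i> (cd f))"

lemma is_iso_iff: "is_iso C a b f \<longleftrightarrow> iso f \<and> dm f = a \<and> cd f = b"
  unfolding is_iso_def iso_def by (auto simp: Hom_iff)

lemma assoc_iso: 
  assumes "a \<in> Obj C" "b \<in> Obj C" "c \<in> Obj C"
  shows "iso (\<a> a b c)" "dm (\<a> a b c) = (a \<diamondop> b) \<diamondop> c" "cd (\<a> a b c) = a \<diamondop> (b \<diamondop> c)"
  using mon7[THEN conjunct1] assms unfolding is_iso_iff by blast+

lemma assoc_arr [simp]:
  assumes "a \<in> Obj C" "b \<in> Obj C" "c \<in> Obj C"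
  shows "arr (\<a> a b c)" "dm (\<a> a b c) = (a \<diamondop> b) \<diamondop> c" "cd (\<a> a b c) = a \<diamondop> (b \<diamondop> c)"
  using assoc_iso[OF assms] by (auto simp: iso_def)

lemma unitor_iso:
  assumes "a \<in> Obj C"
  shows "iso (lu C a)" "dm (lu C a) = E \<diamondop> a" "cd (lu C a) = a"
    "iso (ru C a)" "dm (ru C a) = a \<diamondop> E" "cd (ru C a) = a"
  using mon9[THEN conjunct1] assms unfolding is_iso_iff by blast+

lemma unitor_arr [simp]:
  assumes "a \<in> Obj C"
  shows "arr (lu C a)" "dm (lu C a) = E \<diamondop> a" "cd (lu C a) = a"
    "arr (ru C a)" "dm (ru C a) = a \<diamondop> E" "cd (ru C a) = a"
  using unitor_iso[OF assms] by (auto simp: iso_def)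

lemma assoc_natural:
  assumes "arr f" "arr g" "arr h" "cd f = a" "cd g = b" "cd h = c"
  shows "\<a> a b c \<cdot> ((f \<star> g) \<star> h) = (f \<star> (g \<star> h)) \<cdot> \<a> (dm f) (dm g) (dm h)"
  by (rule mon8[THEN conjunct1, rule_format])
    (use assms in \<open>auto simp: Hom_iff arr_obj\<close>)

lemma unitor_natural:
  assumes "arr f" "dm f = a" "cd f = b"
  shows "lu C b \<cdot> (\<i> E \<star> f) = f \<cdot> lu C a" "ru C b \<cdot> (f \<star> \<i> E) = f \<cdot> ru C a"
  using mon10[THEN conjunct1, rule_format, of a b f]
    arr_obj[OF assms(1)] assms by (simp_all add: Hom_iff)

lemma pentagon:
  assumes "a \<in> Obj C" "b \<in> Obj C" "c \<in> Obj C" "d \<in> Obj C"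
  shows "\<a> a b (c \<diamondop> d) \<cdot> \<a> (a \<diamondop> b) c d = (\<i> a \<star> \<a> b c d) \<cdot> \<a> a (b \<diamondop> c) d \<cdot> (\<a> a b c \<star> \<i> d)"
  using mon11[THEN conjunct1] assms by blast

lemma triangle:
  assumes "a \<in> Obj C" "b \<in> Obj C"
  shows "(\<i> a \<star> lu C b) \<cdot> \<a> a E b = ru C a \<star> \<i> b"
  using mon12 assms by blast

lemma iso_cancel_right:
  assumes "iso f" "arr g" "arr h" "dm g = cd f" "dm h = cd f" "g \<cdot> f = h \<cdot> f"
  shows "g = h"
proof -
  obtain i where i: "arr i" "dm i = cd f" "cd i = dm f" "f \<cdot> i = \<i> (cd f)" "arr f"
    using assms(1) unfolding iso_def by blast
  have "g = (g \<cdot> f) \<cdot> i" using assms(1-5) i by simp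
  also have "\<dots> = h" unfolding assms(6) using assms(1-5) i by simp
  finally show ?thesis .
qed

lemma iso_cancel_left:
  assumes "iso f" "arr g" "arr h" "cd g = dm f" "cd h = dm f" "f \<cdot> g = f \<cdot> h"
  shows "g = h"
proof -
  obtain i where i: "arr i" "dm i = cd f" "cd i = dm f" "i \<cdot> f = \<i> (dm f)" "arr f"
    using assms(1) unfolding iso_def by blast
  have "g = (i \<cdot> f) \<cdot> g" unfolding i(4) using assms(1-5) i by simp
  also have "\<dots> = i \<cdot> f \<cdot> g" using assms(1-5) i by (intro comp_assoc) auto
  also have "\<dots> = (i \<cdot> f) \<cdot> h" unfolding assms(6) using assms(1-5) i by (intro comp_assoc[symmetric]) auto
  also have "\<dots> = h" unfolding i(4) using assms(1-5) i by simp
  finally show ?thesis .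
qed

lemma iso_tensor_ident:
  assumes "iso f" "a \<in> Obj C"
  shows "iso (f \<star> \<i> a)"
proof -
  obtain i where i: "arr i" "dm i = cd f" "cd i = dm f" "i \<cdot> f = \<i> (dm f)" "f \<cdot> i = \<i> (cd f)" "arr f"
    using assms(1) unfolding iso_def by blast
  show ?thesis unfolding iso_def
    by (intro conjI exI[of _ "i \<star> \<i> a"]) (use i assms(2) arr_obj in \<open>simp_all add: interchange\<close>)
qed

section \<open>Unit coherence from pentagon and triangle\<close>

lemma unit_tensor_faithful:
  assumes "arr f" "arr g" "dm f = dm g" "cd f = cd g"
  shows "\<i> E \<star> f = \<i> E \<star> g \<Longrightarrow> f = g" "f \<star> \<i> E = g \<star> \<i> E \<Longrightarrow> f = g"
proof -
  assume "\<i> E \<star> f = \<i> E \<star> g"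
  then have "f \<cdot> lu C (dm f) = g \<cdot> lu C (dm f)"
    using unitor_natural(1)[of f "dm f" "cd f"] unitor_natural(1)[of g "dm f" "cd f"] assms by simp
  then show "f = g" using assms arr_obj by (intro iso_cancel_right[of "lu C (dm f)" f g]) (simp_all add: unitor_iso)
next
  assume "f \<star> \<i> E = g \<star> \<i> E"
  then have "f \<cdot> ru C (dm f) = g \<cdot> ru C (dm f)"
    using unitor_natural(2)[of f "dm f" "cd f"] unitor_natural(2)[of g "dm f" "cd f"] assms by simp
  then show "f = g" using assms arr_obj by (intro iso_cancel_right[of "ru C (dm f)" f g]) (simp_all add: unitor_iso)
qed


text \<open>Kelly's argument: after tensoring with the unit on the left, the pentagon for
  \<open>E\<close>, \<open>E\<close>, \<open>a\<close>, \<open>b\<close> and two triangles make both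
  sides agree up to invertible arrows, and tensoring with the unit is faithful.\<close>

lemma lu_tensor:
  assumes "a \<in> Obj C" "b \<in> Obj C"
  shows "lu C (a \<diamondop> b) \<cdot> \<a> E a b = lu C a \<star> \<i> b"
proof -
  let ?P = "\<a> E (E \<diamondop> a) b" and ?Q = "\<a> E E a \<star> \<i> b"
  let ?L = "\<i> E \<star> (lu C (a \<diamondop> b) \<cdot> \<a> E a b)" and ?R = "\<i> E \<star> (lu C a \<star> \<i> b)"
  have "(?L \<cdot> ?P) \<cdot> ?Q = (\<i> E \<star> lu C (a \<diamondop> b)) \<cdot> (\<i> E \<star> \<a> E a b) \<cdot> ?P \<cdot> ?Q"
    using assms by (simp add: interchange_comp)
  also have "\<dots> = (\<i> E \<star> lu C (a \<diamondop> b)) \<cdot> \<a> E E (a \<diamondop> b) \<cdot> \<a> (E \<diamondop> E) a b"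
    using assms by (simp add: pentagon)
  also have "\<dots> = ((\<i> E \<star> lu C (a \<diamondop> b)) \<cdot> \<a> E E (a \<diamondop> b)) \<cdot> \<a> (E \<diamondop> E) a b"
    using assms by simp
  also have "\<dots> = (ru C E \<star> (\<i> a \<star> \<i> b)) \<cdot> \<a> (E \<diamondop> E) a b"
    using assms by (simp only: triangle tensor_obj_in unit_in ident_tensor)
  also have "\<dots> = \<a> E a b \<cdot> ((ru C E \<star> \<i> a) \<star> \<i> b)"
    using assms by (subst assoc_natural) simp_all
  also have "\<dots> = \<a> E a b \<cdot> (((\<i> E \<star> lu C a) \<cdot> \<a> E E a) \<star> (\<i> b \<cdot> \<i> b))"
    using assms by (simp add: triangle)
  also have "\<dots> = \<a> E a b \<cdot> ((\<i> E \<star> lu C a) \<star> \<i> b) \<cdot> ?Q"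
    using assms by (subst interchange) simp_all
  also have "\<dots> = (\<a> E a b \<cdot> ((\<i> E \<star> lu C a) \<star> \<i> b)) \<cdot> ?Q"
    using assms by simp
  also have "\<dots> = (?R \<cdot> ?P) \<cdot> ?Q"
    using assms by (subst assoc_natural) simp_all
  finally have "?L \<cdot> ?P = ?R \<cdot> ?P"
    using assms by (intro iso_cancel_right[of ?Q "?L \<cdot> ?P" "?R \<cdot> ?P"]) (simp_all add: iso_tensor_ident assoc_iso)
  then have "?L = ?R"
    using assms by (intro iso_cancel_right[of ?P ?L ?R]) (simp_all add: assoc_iso)
  from unit_tensor_faithful(1)[OF _ _ _ _ this] show ?thesis using assms by simp
qed

text \<open>The mirror image, from the pentagon for \<open>a\<close>, \<open>b\<close>,
  \<open>E\<close>, \<open>E\<close>.\<close>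

lemma ru_tensor:
  assumes "a \<in> Obj C" "b \<in> Obj C"
  shows "(\<i> a \<star> ru C b) \<cdot> \<a> a b E = ru C (a \<diamondop> b)"
proof -
  let ?L = "((\<i> a \<star> ru C b) \<cdot> \<a> a b E) \<star> \<i> E" and ?R = "ru C (a \<diamondop> b) \<star> \<i> E"
  have "\<a> a b E \<cdot> ?R = \<a> a b E \<cdot> ((\<i> (a \<diamondop> b) \<star> lu C E) \<cdot> \<a> (a \<diamondop> b) E E)"
    using assms by (simp only: triangle tensor_obj_in unit_in)
  also have "\<dots> = (\<a> a b E \<cdot> ((\<i> a \<star> \<i> b) \<star> lu C E)) \<cdot> \<a> (a \<diamondop> b) E E"
    using assms by simp
  also have "\<dots> = (\<i> a \<star> (\<i> b \<star> lu C E)) \<cdot> \<a> a b (E \<diamondop> E) \<cdot> \<a> (a \<diamondop> b) E E"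
    using assms by (subst assoc_natural) simp_all
  also have "\<dots> = (\<i> a \<star> (\<i> b \<star> lu C E)) \<cdot> (\<i> a \<star> \<a> b E E) \<cdot> \<a> a (b \<diamondop> E) E \<cdot> (\<a> a b E \<star> \<i> E)"
    using assms by (simp add: pentagon)
  also have "\<dots> = ((\<i> a \<cdot> \<i> a) \<star> ((\<i> b \<star> lu C E) \<cdot> \<a> b E E)) \<cdot> \<a> a (b \<diamondop> E) E \<cdot> (\<a> a b E \<star> \<i> E)"
    using assms by (subst interchange_comp) simp_all
  also have "\<dots> = (\<i> a \<star> (ru C b \<star> \<i> E)) \<cdot> \<a> a (b \<diamondop> E) E \<cdot> (\<a> a b E \<star> \<i> E)"
    using assms by (simp add: triangle)
  also have "\<dots> = ((\<i> a \<star> (ru C b \<star> \<i> E)) \<cdot> \<a> a (b \<diamondop> E) E) \<cdot> (\<a> a b E \<star> \<i> E)"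
    using assms by simp
  also have "\<dots> = (\<a> a b E \<cdot> ((\<i> a \<star> ru C b) \<star> \<i> E)) \<cdot> (\<a> a b E \<star> \<i> E)"
    using assms by (subst assoc_natural) simp_all
  also have "\<dots> = \<a> a b E \<cdot> ((\<i> a \<star> ru C b) \<star> \<i> E) \<cdot> (\<a> a b E \<star> \<i> E)"
    using assms by simp
  also have "\<dots> = \<a> a b E \<cdot> ?L"
    using assms by (subst interchange) simp_all
  finally have "?R = ?L"
    using assms by (intro iso_cancel_left[of "\<a> a b E" ?R ?L]) (simp_all add: assoc_iso)
  from unit_tensor_faithful(2)[OF _ _ _ _ this] show ?thesis using assms by simp
qed

text \<open>Naturality of \<open>lu\<close> at the arrow \<open>lu C E\<close> itself identifies
  \<open>\<i> E \<star> lu C E\<close> with \<open>lu C (E \<diamondop> E)\<close>. The triangle and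
  \<open>lu_tensor\<close> then compute the same composite.\<close>

lemma lu_unit: "lu C E = ru C E"
proof -
  have "lu C E \<cdot> (\<i> E \<star> lu C E) = lu C E \<cdot> lu C (E \<diamondop> E)"
    by (rule unitor_natural) simp_all
  then have eq: "\<i> E \<star> lu C E = lu C (E \<diamondop> E)"
    by (intro iso_cancel_left[of "lu C E" "\<i> E \<star> lu C E" "lu C (E \<diamondop> E)"]) (simp_all add: unitor_iso)
  have "lu C E \<star> \<i> E = lu C (E \<diamondop> E) \<cdot> \<a> E E E" by (simp add: lu_tensor)
  also have "\<dots> = ru C E \<star> \<i> E" using triangle[of E E] by (simp add: eq)
  finally have "lu C E \<star> \<i> E = ru C E \<star> \<i> E" .
  from unit_tensor_faithful(2)[OF _ _ _ _ this] show ?thesis by simp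
qed

definition li :: "'o \<Rightarrow> 'm" where "li a = minv C (E \<diamondop> a) a (lu C a)"
definition ri :: "'o \<Rightarrow> 'm" where "ri a = minv C (a \<diamondop> E) a (ru C a)"

lemma minv_props:
  assumes "iso f"
  shows "arr (minv C (dm f) (cd f) f)" "dm (minv C (dm f) (cd f) f) = cd f" "cd (minv C (dm f) (cd f) f) = dm f"
    "minv C (dm f) (cd f) f \<cdot> f = \<i> (dm f)" "f \<cdot> minv C (dm f) (cd f) f = \<i> (cd f)"
proof -
  have "\<exists>g. g \<in> Hom C (cd f) (dm f) \<and> g \<cdot> f = \<i> (dm f) \<and> f \<cdot> g = \<i> (cd f)"
    using assms unfolding iso_def Hom_iff by blast
  then have "minv C (dm f) (cd f) f \<in> Hom C (cd f) (dm f) \<and>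
      minv C (dm f) (cd f) f \<cdot> f = \<i> (dm f) \<and> f \<cdot> minv C (dm f) (cd f) f = \<i> (cd f)"
    unfolding minv_def by (rule someI_ex)
  then show "arr (minv C (dm f) (cd f) f)" "dm (minv C (dm f) (cd f) f) = cd f"
    "cd (minv C (dm f) (cd f) f) = dm f"
    "minv C (dm f) (cd f) f \<cdot> f = \<i> (dm f)" "f \<cdot> minv C (dm f) (cd f) f = \<i> (cd f)"
    by (simp_all add: Hom_iff)
qed

lemma unitor_inv [simp]:
  assumes "a \<in> Obj C"
  shows "arr (li a)" "dm (li a) = a" "cd (li a) = E \<diamondop> a" "li a \<cdot> lu C a = \<i> (E \<diamondop> a)" "lu C a \<cdot> li a = \<i> a"
    "arr (ri a)" "dm (ri a) = a" "cd (ri a) = a \<diamondop> E" "ri a \<cdot> ru C a = \<i> (a \<diamondop> E)" "ru C a \<cdot> ri a = \<i> a"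
  using minv_props[of "lu C a"] minv_props[of "ru C a"] assms by (simp_all add: li_def ri_def unitor_iso)

lemma li_unit: "li E = ri E"
  by (simp add: li_def ri_def lu_unit)

lemma unitor_inv_natural:
  assumes "arr f"
  shows "li (cd f) \<cdot> f = (\<i> E \<star> f) \<cdot> li (dm f)" "ri (cd f) \<cdot> f = (f \<star> \<i> E) \<cdot> ri (dm f)"
proof -
  note [simp] = arr_obj[OF assms] assms
  have "lu C (cd f) \<cdot> (\<i> E \<star> f) \<cdot> li (dm f) = (lu C (cd f) \<cdot> (\<i> E \<star> f)) \<cdot> li (dm f)" by simp
  also have "\<dots> = (f \<cdot> lu C (dm f)) \<cdot> li (dm f)" by (simp only: unitor_natural[OF assms refl refl])
  also have "\<dots> = lu C (cd f) \<cdot> li (cd f) \<cdot> f" by (simp flip: comp_assoc[of f "li (cd f)" "lu C (cd f)"])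
  finally show "li (cd f) \<cdot> f = (\<i> E \<star> f) \<cdot> li (dm f)"
    by (intro iso_cancel_left[of "lu C (cd f)" "li (cd f) \<cdot> f" "(\<i> E \<star> f) \<cdot> li (dm f)"]) (simp_all add: unitor_iso)
  have "ru C (cd f) \<cdot> (f \<star> \<i> E) \<cdot> ri (dm f) = (ru C (cd f) \<cdot> (f \<star> \<i> E)) \<cdot> ri (dm f)" by simp
  also have "\<dots> = (f \<cdot> ru C (dm f)) \<cdot> ri (dm f)" by (simp only: unitor_natural[OF assms refl refl])
  also have "\<dots> = ru C (cd f) \<cdot> ri (cd f) \<cdot> f" by (simp flip: comp_assoc[of f "ri (cd f)" "ru C (cd f)"])
  finally show "ri (cd f) \<cdot> f = (f \<star> \<i> E) \<cdot> ri (dm f)"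
    by (intro iso_cancel_left[of "ru C (cd f)" "ri (cd f) \<cdot> f" "(f \<star> \<i> E) \<cdot> ri (dm f)"]) (simp_all add: unitor_iso)
qed

text \<open>The unit in each of the three slots of the associator, stated for inverse unitors
  because trees grow from the root to the leaves. This is the source of the entries 1 in
  \<open>spread\<close> and \<open>inner\<close>.\<close>

lemma assoc_unitor_inv:
  assumes "a \<in> Obj C" "b \<in> Obj C"
  shows "\<a> E a b \<cdot> (li a \<star> \<i> b) = li (a \<diamondop> b)"
    "\<a> a E b \<cdot> (ri a \<star> \<i> b) = \<i> a \<star> li b"
    "\<a> a b E \<cdot> ri (a \<diamondop> b) = \<i> a \<star> ri b"
proof -
  note [simp] = assms
  have "lu C (a \<diamondop> b) \<cdot> \<a> E a b \<cdot> (li a \<star> \<i> b) = (lu C (a \<diamondop> b) \<cdot> \<a> E a b) \<cdot> (li a \<star> \<i> b)" by simp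
  also have "\<dots> = lu C (a \<diamondop> b) \<cdot> li (a \<diamondop> b)" by (simp add: lu_tensor interchange del: comp_assoc)
  finally show "\<a> E a b \<cdot> (li a \<star> \<i> b) = li (a \<diamondop> b)"
    by (intro iso_cancel_left[of "lu C (a \<diamondop> b)" "\<a> E a b \<cdot> (li a \<star> \<i> b)" "li (a \<diamondop> b)"]) (simp_all add: unitor_iso)
  have iso: "iso (\<i> a \<star> lu C b)" "iso (\<i> a \<star> ru C b)"
    unfolding iso_def
    by (intro conjI exI[of _ "\<i> a \<star> li b"], simp_all add: interchange)
      (intro conjI exI[of _ "\<i> a \<star> ri b"], simp_all add: interchange)
  have "(\<i> a \<star> lu C b) \<cdot> \<a> a E b \<cdot> (ri a \<star> \<i> b) = ((\<i> a \<star> lu C b) \<cdot> \<a> a E b) \<cdot> (ri a \<star> \<i> b)" by simp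
  also have "\<dots> = (\<i> a \<star> lu C b) \<cdot> (\<i> a \<star> li b)" by (simp add: triangle interchange del: comp_assoc)
  finally have "(\<i> a \<star> lu C b) \<cdot> \<a> a E b \<cdot> (ri a \<star> \<i> b) = (\<i> a \<star> lu C b) \<cdot> (\<i> a \<star> li b)" .
  from iso_cancel_left[OF iso(1) _ _ _ _ this]
  show "\<a> a E b \<cdot> (ri a \<star> \<i> b) = \<i> a \<star> li b" by simp
  have "(\<i> a \<star> ru C b) \<cdot> \<a> a b E \<cdot> ri (a \<diamondop> b) = ((\<i> a \<star> ru C b) \<cdot> \<a> a b E) \<cdot> ri (a \<diamondop> b)" by simp
  also have "\<dots> = (\<i> a \<star> ru C b) \<cdot> (\<i> a \<star> ri b)" by (simp add: ru_tensor interchange del: comp_assoc)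
  finally have "(\<i> a \<star> ru C b) \<cdot> \<a> a b E \<cdot> ri (a \<diamondop> b) = (\<i> a \<star> ru C b) \<cdot> (\<i> a \<star> ri b)" .
  from iso_cancel_left[OF iso(2) _ _ _ _ this]
  show "\<a> a b E \<cdot> ri (a \<diamondop> b) = \<i> a \<star> ri b" by simp
qed

text \<open>Naturality lets the vertex \<open>f\<close>, sitting in one slot, slide through the
  associator and stay inert; the tail \<open>t\<close> allows use inside a longer composite. The
  next two lemmas treat the other slots.\<close>

lemma assoc_comp_left:
  assumes "arr f" "arr g" "arr t" "cd g = dm f \<diamondop> b" "b \<in> Obj C" "d \<in> Obj C" "cd t = dm g \<diamondop> d" "cd f = a"
  shows "\<a> a b d \<cdot> (((f \<star> \<i> b) \<cdot> g) \<star> \<i> d) \<cdot> t = (f \<star> \<i> (b \<diamondop> d)) \<cdot> \<a> (dm f) b d \<cdot> (g \<star> \<i> d) \<cdot> t"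
proof -
  note [simp] = assms(1-7) assms(8)[symmetric] arr_obj[OF assms(1)] arr_obj[OF assms(2)]
  have "((f \<star> \<i> b) \<cdot> g) \<star> \<i> d = ((f \<star> \<i> b) \<cdot> g) \<star> (\<i> d \<cdot> \<i> d)" by simp
  also have "\<dots> = ((f \<star> \<i> b) \<star> \<i> d) \<cdot> (g \<star> \<i> d)" by (subst interchange) simp_all
  finally have "\<a> a b d \<cdot> (((f \<star> \<i> b) \<cdot> g) \<star> \<i> d) \<cdot> t = (\<a> a b d \<cdot> ((f \<star> \<i> b) \<star> \<i> d)) \<cdot> (g \<star> \<i> d) \<cdot> t"
    by simp
  also have "\<dots> = ((f \<star> (\<i> b \<star> \<i> d)) \<cdot> \<a> (dm f) b d) \<cdot> (g \<star> \<i> d) \<cdot> t"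
    by (subst assoc_natural) simp_all
  finally show ?thesis by simp
qed

lemma assoc_comp_mid:
  assumes "arr f" "arr g" "arr t" "cd g = a \<diamondop> dm f" "a \<in> Obj C" "d \<in> Obj C" "cd t = dm g \<diamondop> d" "cd f = b"
  shows "\<a> a b d \<cdot> (((\<i> a \<star> f) \<cdot> g) \<star> \<i> d) \<cdot> t = (\<i> a \<star> (f \<star> \<i> d)) \<cdot> \<a> a (dm f) d \<cdot> (g \<star> \<i> d) \<cdot> t"
proof -
  note [simp] = assms(1-7) assms(8)[symmetric] arr_obj[OF assms(1)] arr_obj[OF assms(2)]
  have "((\<i> a \<star> f) \<cdot> g) \<star> \<i> d = ((\<i> a \<star> f) \<cdot> g) \<star> (\<i> d \<cdot> \<i> d)" by simp
  also have "\<dots> = ((\<i> a \<star> f) \<star> \<i> d) \<cdot> (g \<star> \<i> d)" by (subst interchange) simp_all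
  finally have "\<a> a b d \<cdot> (((\<i> a \<star> f) \<cdot> g) \<star> \<i> d) \<cdot> t = (\<a> a b d \<cdot> ((\<i> a \<star> f) \<star> \<i> d)) \<cdot> (g \<star> \<i> d) \<cdot> t"
    by simp
  also have "\<dots> = ((\<i> a \<star> (f \<star> \<i> d)) \<cdot> \<a> a (dm f) d) \<cdot> (g \<star> \<i> d) \<cdot> t"
    by (subst assoc_natural) simp_all
  finally show ?thesis by simp
qed

lemma assoc_comp_right:
  assumes "arr f" "arr h" "arr t" "cd f = a \<diamondop> b" "a \<in> Obj C" "b \<in> Obj C" "cd t = dm f \<diamondop> dm h" "cd h = d"
  shows "\<a> a b d \<cdot> (f \<star> h) \<cdot> t = (\<i> a \<star> (\<i> b \<star> h)) \<cdot> \<a> a b (dm h) \<cdot> (f \<star> \<i> (dm h)) \<cdot> t"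
proof -
  note [simp] = assms(1-7) assms(8)[symmetric] arr_obj[OF assms(1)] arr_obj[OF assms(2)]
  have "f \<star> h = ((\<i> a \<star> \<i> b) \<cdot> f) \<star> (h \<cdot> \<i> (dm h))" by simp
  also have "\<dots> = ((\<i> a \<star> \<i> b) \<star> h) \<cdot> (f \<star> \<i> (dm h))" by (subst interchange) simp_all
  finally have "\<a> a b d \<cdot> (f \<star> h) \<cdot> t = (\<a> a b d \<cdot> ((\<i> a \<star> \<i> b) \<star> h)) \<cdot> (f \<star> \<i> (dm h)) \<cdot> t"
    by simp
  also have "\<dots> = ((\<i> a \<star> (\<i> b \<star> h)) \<cdot> \<a> a b (dm h)) \<cdot> (f \<star> \<i> (dm h)) \<cdot> t"
    by (subst assoc_natural) simp_all
  finally show ?thesis by simp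
qed

section \<open>Linear functionals on hom-spaces\<close>

definition linfun :: "'o \<Rightarrow> 'o \<Rightarrow> ('m \<Rightarrow> 'r) \<Rightarrow> bool" where
  "linfun x y \<l> \<longleftrightarrow> x \<in> Obj C \<and> y \<in> Obj C \<and>
    (\<forall>f g. arr f \<and> dm f = x \<and> cd f = y \<longrightarrow>
      (\<forall>r. \<l> (msmul C r f) = r * \<l> f) \<and>
      (arr g \<and> dm g = x \<and> cd g = y \<longrightarrow> \<l> (madd C f g) = \<l> f + \<l> g))"

lemma linfun_smul: "linfun x y \<l> \<Longrightarrow> arr f \<Longrightarrow> dm f = x \<Longrightarrow> cd f = y \<Longrightarrow> \<l> (msmul C r f) = r * \<l> f"
  by (auto simp: linfun_def)

lemma linfun_zero: "linfun x y \<l> \<Longrightarrow> \<l> (mzero C x y) = 0"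
  using linfun_smul[of x y \<l> "mzero C x y" 0] by (simp add: linfun_def)

text \<open>This and the next three rules pull functionals back along composition and tensoring, so
  an expansion known for one arrow can be applied in the middle of a larger diagram.\<close>

lemma linfun_comp:
  assumes "linfun x z \<l>" "arr p" "dm p = y" "cd p = z"
  shows "linfun x y (\<lambda>g. \<l> (p \<cdot> g))"
  using assms arr_obj[OF assms(2)] by (auto simp: linfun_def comp_linear)

lemma linfun_comp_right:
  assumes "linfun x z \<l>" "arr t" "dm t = x" "cd t = y"
  shows "linfun y z (\<lambda>g. \<l> (g \<cdot> t))"
  using assms arr_obj[OF assms(2)] by (auto simp: linfun_def comp_linear)

lemma linfun_tensor_left:
  assumes "linfun (a \<diamondop> dm h) (b \<diamondop> cd h) \<l>" "arr h" "a \<in> Obj C" "b \<in> Obj C"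
  shows "linfun a b (\<lambda>g. \<l> (g \<star> h))"
  using assms by (auto simp: linfun_def tensor_linear)

lemma linfun_tensor_right:
  assumes "linfun (dm h \<diamondop> a) (cd h \<diamondop> b) \<l>" "arr h" "a \<in> Obj C" "b \<in> Obj C"
  shows "linfun a b (\<lambda>g. \<l> (h \<star> g))"
  using assms by (auto simp: linfun_def tensor_linear)

text \<open>
  \<open>p \<cdot> T u\<close> is the linear combination of the \<open>T' v\<close> with coefficients \<open>M v u\<close>. Testing this against
  linear functionals keeps all sums in the ground field.
\<close>

definition rep :: "'o \<Rightarrow> 'm \<Rightarrow> 'i set \<Rightarrow> ('i \<Rightarrow> 'm) \<Rightarrow> ('i \<Rightarrow> 'm) \<Rightarrow> ('i \<Rightarrow> 'i \<Rightarrow> 'r) \<Rightarrow> bool" where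
  "rep x p S T T' M \<longleftrightarrow> (\<forall>u\<in>S. \<forall>\<l>. linfun x (cd p) \<l> \<longrightarrow> \<l> (p \<cdot> T u) = (\<Sum>v\<in>S. M v u * \<l> (T' v)))"

lemma rep_comp:
  assumes "rep x p S T T' M" "rep x q S T' T'' N" "arr p" "arr q" "dm q = cd p"
    "\<And>u. u \<in> S \<Longrightarrow> arr (T u) \<and> cd (T u) = dm p"
  shows "rep x (q \<cdot> p) S T T'' (mmul S N M)"
  unfolding rep_def
proof (intro ballI allI impI)
  fix u \<l> assume u: "u \<in> S" and \<l>: "linfun x (cd (q \<cdot> p)) \<l>"
  have "linfun x (cd q) \<l>" using \<l> assms by simp
  then have l: "linfun x (cd p) (\<lambda>g. \<l> (q \<cdot> g))" using assms by (intro linfun_comp) auto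
  have "\<l> ((q \<cdot> p) \<cdot> T u) = (\<Sum>v\<in>S. M v u * \<l> (q \<cdot> T' v))"
    using assms(1)[unfolded rep_def, rule_format, OF u l] assms(3-5) assms(6)[OF u] by simp
  also have "\<dots> = (\<Sum>v\<in>S. M v u * (\<Sum>w\<in>S. N w v * \<l> (T'' w)))"
    using assms(2) \<open>linfun x (cd q) \<l>\<close> by (intro sum.cong refl) (simp add: rep_def)
  also have "\<dots> = (\<Sum>w\<in>S. \<Sum>v\<in>S. N w v * M v u * \<l> (T'' w))"
    unfolding sum_distrib_left by (subst sum.swap) (simp add: ac_simps)
  finally show "\<l> ((q \<cdot> p) \<cdot> T u) = (\<Sum>w\<in>S. mmul S N M w u * \<l> (T'' w))"
    by (simp add: mmul_def sum_distrib_right)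
qed

text \<open>A functional dual to the single basis element \<open>T' v\<close> reads off row
  \<open>v\<close>.\<close>

lemma rep_unique:
  assumes "rep x p S T T' M" "rep x p S T T' N" "finite S" "u \<in> S" "v \<in> S"
    and "linfun x (cd p) \<l>" "\<And>w. w \<in> S \<Longrightarrow> \<l> (T' w) = (if w = v then 1 else 0)"
  shows "M v u = N v u"
proof -
  have "\<l> (p \<cdot> T u) = M v u" if "rep x p S T T' M" for M
  proof -
    have "\<l> (p \<cdot> T u) = (\<Sum>w\<in>S. M w u * (if w = v then 1 else 0))"
      using that[unfolded rep_def, rule_format, OF assms(4,6)] assms(7) by simp
    also have "\<dots> = (\<Sum>w\<in>S. if w = v then M w u else 0)" by (rule sum.cong) auto
    finally show ?thesis using assms(3,5) by simp
  qed
  from this[OF assms(1)] this[OF assms(2)] show ?thesis by simp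
qed

end

section \<open>Near-group categories\<close>

lemma vspace_smul_inject:
  assumes V: "vspace V ad z sm" and v: "v \<in> V" "v \<noteq> z" and eq: "sm r v = sm s v"
  shows "r = s"
proof (rule ccontr)
  assume "r \<noteq> s"
  have one: "\<forall>x\<in>V. sm 1 x = x"
    and mult: "\<forall>c d. \<forall>x\<in>V. sm (c * d) x = sm c (sm d x)"
    and dist: "\<forall>c d. \<forall>x\<in>V. sm (c + d) x = ad (sm c x) (sm d x)"
    using V unfolding vspace_def by - (elim conjE, assumption)+
  have "sm (r + - s) v = sm (s + - s) v"
    using dist[rule_format, OF v(1), of r "- s"] dist[rule_format, OF v(1), of s "- s"] eq by simp
  then have "sm (r - s) v = sm 0 v" by simp
  then have "sm (inverse (r - s) * (r - s)) v = sm (inverse (r - s) * 0) v"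
    by (simp only: mult[rule_format, OF v(1)])
  then have "v = sm 0 v" using \<open>r \<noteq> s\<close> one v by simp
  then show False using vspace_smul_0[OF V v(1)] v(2) by simp
qed

section \<open>Vector space laws and direct sums\<close>

context linear_monoidal_category
begin

lemma smul_add:
  assumes "arr f"
  shows "msmul C (r + s) f = madd C (msmul C r f) (msmul C s f)"
    "msmul C (r * s) f = msmul C r (msmul C s f)" "msmul C 1 f = f"
proof -
  have one: "\<forall>x\<in>Hom C (dm f) (cd f). msmul C 1 x = x"
    and mult: "\<forall>c d. \<forall>x\<in>Hom C (dm f) (cd f). msmul C (c * d) x = msmul C c (msmul C d x)"
    and dist: "\<forall>c d. \<forall>x\<in>Hom C (dm f) (cd f). msmul C (c + d) x = madd C (msmul C c x) (msmul C d x)"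
    using vspace_Hom[OF arr_obj, OF assms assms] unfolding vspace_def by - (elim conjE, assumption)+
  show "msmul C (r + s) f = madd C (msmul C r f) (msmul C s f)"
    "msmul C (r * s) f = msmul C r (msmul C s f)" "msmul C 1 f = f"
    using in_Hom[OF assms] one mult dist by blast+
qed

lemma add_assoc:
  assumes "arr f" "arr g" "arr h" "dm g = dm f" "cd g = cd f" "dm h = dm f" "cd h = cd f"
  shows "madd C (madd C f g) h = madd C f (madd C g h)"
proof -
  have "\<forall>x\<in>Hom C (dm f) (cd f). \<forall>y\<in>Hom C (dm f) (cd f). \<forall>w\<in>Hom C (dm f) (cd f).
      madd C (madd C x y) w = madd C x (madd C y w)"
    using vspace_Hom[OF arr_obj, OF assms(1,1)] unfolding vspace_def by - (elim conjE, assumption)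
  then show ?thesis using assms by (simp add: Hom_iff)
qed

lemma add_zero:
  assumes "arr f"
  shows "madd C (mzero C (dm f) (cd f)) f = f" "madd C f (mzero C (dm f) (cd f)) = f"
proof -
  have z: "\<forall>x\<in>Hom C (dm f) (cd f). madd C (mzero C (dm f) (cd f)) x = x"
    and comm: "\<forall>x\<in>Hom C (dm f) (cd f). \<forall>y\<in>Hom C (dm f) (cd f). madd C x y = madd C y x"
    using vspace_Hom[OF arr_obj, OF assms assms] unfolding vspace_def by - (elim conjE, assumption)+
  show 1: "madd C (mzero C (dm f) (cd f)) f = f" using z in_Hom[OF assms] by blast
  have "mzero C (dm f) (cd f) \<in> Hom C (dm f) (cd f)" using assms by (simp add: Hom_iff arr_obj)
  then show "madd C f (mzero C (dm f) (cd f)) = f" using 1 comm in_Hom[OF assms] by metis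
qed

lemma eq_if_diff_zero:
  assumes "arr f" "arr g" "dm g = dm f" "cd g = cd f"
    and "madd C f (msmul C (-1) g) = mzero C (dm f) (cd f)"
  shows "f = g"
proof -
  have "madd C (msmul C (-1) g) g = msmul C (-1 + 1) g"
    using assms(2) smul_add(1)[of g "-1" 1] smul_add(3)[of g] by simp
  then have inv: "madd C (msmul C (-1) g) g = mzero C (dm f) (cd f)" using assms by simp
  have "g = madd C (mzero C (dm f) (cd f)) g" using add_zero(1)[OF assms(2)] assms(3,4) by simp
  also have "\<dots> = madd C (madd C f (msmul C (-1) g)) g" by (simp only: assms(5))
  also have "\<dots> = madd C f (madd C (msmul C (-1) g) g)" using assms(1-4) by (intro add_assoc) simp_all
  also have "\<dots> = f" unfolding inv by (rule add_zero(2)[OF assms(1)])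
  finally show ?thesis by simp
qed

text \<open>A direct sum resolves its identity by a \<open>foldr\<close> over \<open>madd\<close>.
  Functionals turn it into a sum in the field; the last clause is a test for vanishing. One
  induction proves all three, since each needs the typing of the tail.\<close>

lemma foldr_add:
  assumes "s \<in> Obj C" "\<And>i. i \<in> set js \<Longrightarrow> arr (t i) \<and> dm (t i) = s \<and> cd (t i) = s"
  defines "F \<equiv> foldr (\<lambda>i acc. madd C (t i) acc) js (mzero C s s)"
  shows "arr F \<and> dm F = s \<and> cd F = s"
    "linfun s s \<l> \<Longrightarrow> \<l> F = sum_list (map (\<lambda>i. \<l> (t i)) js)"
    "arr n \<Longrightarrow> dm n = s \<Longrightarrow> (\<And>i. i \<in> set js \<Longrightarrow> n \<cdot> t i = mzero C s (cd n)) \<Longrightarrow> n \<cdot> F = mzero C s (cd n)"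
proof -
  have *: "arr F \<and> dm F = s \<and> cd F = s \<and> (linfun s s \<l> \<longrightarrow> \<l> F = sum_list (map (\<lambda>i. \<l> (t i)) js)) \<and>
     (arr n \<and> dm n = s \<and> (\<forall>i\<in>set js. n \<cdot> t i = mzero C s (cd n)) \<longrightarrow> n \<cdot> F = mzero C s (cd n))"
    using assms(2) unfolding F_def
  proof (induction js)
    case Nil
    show ?case using assms(1) by (auto simp: linfun_zero)
  next
    case (Cons i js)
    let ?F = "foldr (\<lambda>i acc. madd C (t i) acc) js (mzero C s s)"
    have t: "arr (t i)" "dm (t i) = s" "cd (t i) = s" using Cons.prems by auto
    have IH: "arr ?F" "dm ?F = s" "cd ?F = s"
      "linfun s s \<l> \<Longrightarrow> \<l> ?F = sum_list (map (\<lambda>i. \<l> (t i)) js)"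
      "arr n \<Longrightarrow> dm n = s \<Longrightarrow> \<forall>i\<in>set js. n \<cdot> t i = mzero C s (cd n) \<Longrightarrow> n \<cdot> ?F = mzero C s (cd n)"
      using Cons by auto
    have "\<l> (madd C (t i) ?F) = \<l> (t i) + \<l> ?F" if "linfun s s \<l>"
      using that t IH(1-3) unfolding linfun_def by blast
    moreover have "n \<cdot> madd C (t i) ?F = mzero C s (cd n)"
      if "arr n" "dm n = s" "\<forall>j\<in>set (i # js). n \<cdot> t j = mzero C s (cd n)"
      using that t IH(1-3,5) add_zero(1)[of "mzero C s (cd n)"] assms(1) by (simp add: comp_linear arr_obj)
    ultimately show ?case using t IH by simp
  qed
  show "arr F \<and> dm F = s \<and> cd F = s"
    "linfun s s \<l> \<Longrightarrow> \<l> F = sum_list (map (\<lambda>i. \<l> (t i)) js)"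
    "arr n \<Longrightarrow> dm n = s \<Longrightarrow> (\<And>i. i \<in> set js \<Longrightarrow> n \<cdot> t i = mzero C s (cd n)) \<Longrightarrow> n \<cdot> F = mzero C s (cd n)"
    using * by blast+
qed

lemma dsumE:
  assumes "dsum C s xs"
  obtains \<iota> \<pi> where
    "\<And>i. i < length xs \<Longrightarrow> arr (\<iota> i) \<and> dm (\<iota> i) = xs ! i \<and> cd (\<iota> i) = s"
    "\<And>i. i < length xs \<Longrightarrow> arr (\<pi> i) \<and> dm (\<pi> i) = s \<and> cd (\<pi> i) = xs ! i"
    "\<And>i j. i < length xs \<Longrightarrow> j < length xs \<Longrightarrow>
      \<pi> i \<cdot> \<iota> j = (if i = j then \<i> (xs ! i) else mzero C (xs ! j) (xs ! i))"
    "\<And>\<l>. linfun s s \<l> \<Longrightarrow> \<l> (\<i> s) = (\<Sum>i<length xs. \<l> (\<iota> i \<cdot> \<pi> i))"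
    "\<And>n. arr n \<Longrightarrow> dm n = s \<Longrightarrow> (\<And>i. i < length xs \<Longrightarrow> n \<cdot> \<iota> i = mzero C (xs ! i) (cd n)) \<Longrightarrow>
      n = mzero C s (cd n)"
proof -
  from assms obtain \<iota> \<pi> where s: "s \<in> Obj C" and xs: "set xs \<subseteq> Obj C" and
    ty: "\<forall>i<length xs. \<iota> i \<in> Hom C (xs ! i) s \<and> \<pi> i \<in> Hom C s (xs ! i)" and
    orth: "\<forall>i<length xs. \<forall>j<length xs. \<pi> i \<cdot> \<iota> j =
           (if i = j then \<i> (xs ! i) else mzero C (xs ! j) (xs ! i))" and
    id: "foldr (\<lambda>i acc. madd C (\<iota> i \<cdot> \<pi> i) acc) [0..<length xs] (mzero C s s) = \<i> s"
    unfolding dsum_def by blast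
  have 1: "arr (\<iota> i) \<and> dm (\<iota> i) = xs ! i \<and> cd (\<iota> i) = s" if "i < length xs" for i
    using ty that by (simp add: Hom_iff)
  have 2: "arr (\<pi> i) \<and> dm (\<pi> i) = s \<and> cd (\<pi> i) = xs ! i" if "i < length xs" for i
    using ty that by (simp add: Hom_iff)
  have 12: "arr (\<iota> i \<cdot> \<pi> i) \<and> dm (\<iota> i \<cdot> \<pi> i) = s \<and> cd (\<iota> i \<cdot> \<pi> i) = s" if "i \<in> set [0..<length xs]" for i
    using 1[of i] 2[of i] that by simp
  note fa = foldr_add[where t="\<lambda>i. \<iota> i \<cdot> \<pi> i" and js="[0..<length xs]", OF s 12, unfolded id]
  have 4: "\<l> (\<i> s) = (\<Sum>i<length xs. \<l> (\<iota> i \<cdot> \<pi> i))" if "linfun s s \<l>" for \<l>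
    using fa(2)[OF _ that] by (simp add: interv_sum_list_conv_sum_set_nat atLeast0LessThan)
  have 5: "n = mzero C s (cd n)" if n: "arr n" "dm n = s"
    "\<And>i. i < length xs \<Longrightarrow> n \<cdot> \<iota> i = mzero C (xs ! i) (cd n)" for n
  proof -
    have "n \<cdot> (\<iota> i \<cdot> \<pi> i) = mzero C s (cd n)" if i: "i \<in> set [0..<length xs]" for i
    proof -
      have "n \<cdot> (\<iota> i \<cdot> \<pi> i) = (n \<cdot> \<iota> i) \<cdot> \<pi> i" using n(1,2) 1[of i] 2[of i] i by simp
      also have "\<dots> = mzero C s (cd n)" using n 2[of i] i arr_obj[OF n(1)] by simp
      finally show ?thesis .
    qed
    from fa(3)[OF _ n(1,2) this] show ?thesis using n(1,2) by simp
  qed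
  show thesis by (rule that[OF 1 2 _ 4 5]) (use orth in auto)
qed

end

section \<open>Schur's lemma for the two simple objects\<close>

locale near_group_category = linear_monoidal_category C
  for C :: "('o, 'm, 'r::field) cat_data" +
  fixes m :: 'o and k :: nat
  assumes ng: "near_group_trivial C m k"
begin

lemma simple_unit: "simple C E" and simple_m: "simple C m"
  and simple_iso: "simple C s \<Longrightarrow> iso_obj C s E \<or> iso_obj C s m"
  and simple_end: "simple C s \<Longrightarrow> x \<in> Hom C s s \<Longrightarrow> \<exists>r. x = msmul C r (\<i> s)"
  and semisimple: "x0 \<in> Obj C \<Longrightarrow> \<exists>xs. (\<forall>y\<in>set xs. simple C y) \<and> dsum C x0 xs"
  and dsum_mm: "dsum C (m \<diamondop> m) (E # replicate k m)"
  and rigid: "rigid C"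
  using ng unfolding near_group_trivial_def by auto

lemma m_obj [simp]: "m \<in> Obj C"
  using simple_m by (simp add: simple_def)

lemma Hom_unit_m: "arr g \<Longrightarrow> dm g = E \<Longrightarrow> cd g = m \<Longrightarrow> g = mzero C E m"
  using ng in_Hom[of g] unfolding near_group_trivial_def by auto

text \<open>The scalar of an endomorphism of a simple object; it is the basic functional from which
  all others are pulled back.\<close>

definition sc :: "'o \<Rightarrow> 'm \<Rightarrow> 'r" where
  "sc x g = (THE r. g = msmul C r (\<i> x))"

lemma smul_ident_inject:
  assumes "simple C x" "msmul C r (\<i> x) = msmul C s (\<i> x)"
  shows "r = s"
  using assms by (intro vspace_smul_inject[OF vspace_Hom[of x x]]) (auto simp: simple_def Hom_iff)

lemma sc_smul: "simple C x \<Longrightarrow> sc x (msmul C r (\<i> x)) = r"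
  unfolding sc_def by (rule the_equality) (auto dest: smul_ident_inject)

lemma smul_sc:
  assumes "simple C x" "arr g" "dm g = x" "cd g = x"
  shows "g = msmul C (sc x g) (\<i> x)"
proof -
  obtain r where "g = msmul C r (\<i> x)" using simple_end[OF assms(1)] assms by (auto simp: Hom_iff)
  then show ?thesis using sc_smul[OF assms(1)] by simp
qed

lemma sc_ident: "simple C x \<Longrightarrow> sc x (\<i> x) = 1"
  using sc_smul[of x 1] smul_add(3)[of "\<i> x"] by (simp add: simple_def)

lemma linfun_sc:
  assumes x: "simple C x"
  shows "linfun x x (sc x)"
proof -
  have [simp]: "x \<in> Obj C" using x by (simp add: simple_def)
  have "sc x (msmul C r g) = r * sc x g" if g: "arr g" "dm g = x" "cd g = x" for r g
  proof -
    obtain a where a: "g = msmul C a (\<i> x)" using smul_sc[OF x g] by blast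
    then have "msmul C r g = msmul C (r * a) (\<i> x)" by (simp add: smul_add(2))
    then show ?thesis using a by (simp add: sc_smul[OF x])
  qed
  moreover have "sc x (madd C g h) = sc x g + sc x h"
    if g: "arr g" "dm g = x" "cd g = x" and h: "arr h" "dm h = x" "cd h = x" for g h
  proof -
    obtain a where a: "g = msmul C a (\<i> x)" using smul_sc[OF x g] by blast
    obtain b where b: "h = msmul C b (\<i> x)" using smul_sc[OF x h] by blast
    have "madd C g h = msmul C (a + b) (\<i> x)" using a b by (simp add: smul_add(1))
    then show ?thesis using a b by (simp add: sc_smul[OF x])
  qed
  ultimately show ?thesis by (simp add: linfun_def)
qed

text \<open>Factoring the identity of \<open>s\<close> through \<open>E\<close> or \<open>m\<close>
  reduces statements about arbitrary simple summands to these two objects.\<close>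

lemma simple_coverE:
  assumes "simple C s"
  obtains x q q' where "x = E \<or> x = m" "arr q" "dm q = x" "cd q = s" "arr q'" "dm q' = s" "cd q' = x" "q \<cdot> q' = \<i> s"
proof -
  from simple_iso[OF assms] obtain x where "x = E \<or> x = m" "iso_obj C s x" by blast
  then obtain q' where "iso q'" "dm q' = s" "cd q' = x" unfolding iso_obj_def is_iso_iff by blast
  then obtain q where "arr q'" "dm q' = s" "cd q' = x" "arr q" "dm q = x" "cd q = s" "q \<cdot> q' = \<i> s"
    unfolding iso_def by blast
  with \<open>x = E \<or> x = m\<close> show thesis using that by blast
qed

text \<open>The definition gives only that arrows from \<open>E\<close> to \<open>m\<close> vanish.
  If \<open>g\<close> is nonzero, it is mono, hence invertible because \<open>E\<close> is simple;
  its inverse is an arrow from \<open>E\<close> to \<open>m\<close> and therefore zero, which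
  contradicts \<open>\<i> m\<close> being nonzero.\<close>

lemma Hom_m_unit:
  assumes g: "arr g" "dm g = m" "cd g = E"
  shows "g = mzero C m E"
proof (rule ccontr)
  assume g0: "g \<noteq> mzero C m E"
  have "mono C m E g"
    unfolding mono_def
  proof (intro conjI ballI impI)
    show "g \<in> Hom C m E" using g by (simp add: Hom_iff)
  next
    fix y h h' assume y: "y \<in> Obj C" and "h \<in> Hom C y m" "h' \<in> Hom C y m" and eq: "g \<cdot> h = g \<cdot> h'"
    then have h: "arr h" "dm h = y" "cd h = m" "arr h'" "dm h' = y" "cd h' = m" by (simp_all add: Hom_iff)
    define n where "n = madd C h (msmul C (-1) h')"
    have n: "arr n" "dm n = y" "cd n = m" using h by (simp_all add: n_def)
    have "g \<cdot> n = madd C (g \<cdot> h') (msmul C (-1) (g \<cdot> h'))"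
      using h g eq by (simp add: n_def comp_linear)
    also have "\<dots> = msmul C (1 + -1) (g \<cdot> h')"
      using h g smul_add(1)[of "g \<cdot> h'" 1 "-1"] smul_add(3)[of "g \<cdot> h'"] by simp
    finally have gn: "g \<cdot> n = mzero C y E" using h g by simp
    obtain xs where xs: "\<forall>s\<in>set xs. simple C s" "dsum C y xs" using semisimple[OF y] by blast
    from xs(2) obtain \<iota> \<pi> where
      \<iota>: "\<And>i. i < length xs \<Longrightarrow> arr (\<iota> i) \<and> dm (\<iota> i) = xs ! i \<and> cd (\<iota> i) = y"
      and zero: "\<And>n. arr n \<Longrightarrow> dm n = y \<Longrightarrow>
        (\<And>i. i < length xs \<Longrightarrow> n \<cdot> \<iota> i = mzero C (xs ! i) (cd n)) \<Longrightarrow> n = mzero C y (cd n)"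
      by (rule dsumE) blast
    have "n = mzero C y (cd n)"
    proof (rule zero[OF n(1,2)])
      fix i assume i: "i < length xs"
      let ?s = "xs ! i"
      have "simple C ?s" using xs(1) i by simp
      then obtain x q q' where q: "x = E \<or> x = m" "arr q" "dm q = x" "cd q = ?s"
        "arr q'" "dm q' = ?s" "cd q' = x" "q \<cdot> q' = \<i> ?s" by (rule simple_coverE)
      note \<iota>i = \<iota>[OF i]
      let ?w = "n \<cdot> \<iota> i \<cdot> q"
      have w: "arr ?w" "dm ?w = x" "cd ?w = m" using n \<iota>i q(2-4) by simp_all
      have "?w = mzero C x m"
      \<comment> \<open>To see that \<open>n\<close> is zero it is tested on simple summands of
        \<open>y\<close>. On \<open>E\<close> it vanishes by hypothesis; on \<open>m\<close> it is a
        scalar \<open>r\<close> with \<open>r\<close> times \<open>g\<close> zero, so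
        \<open>r = 0\<close>.\<close>
      proof (cases "x = E")
        case True then show ?thesis using Hom_unit_m[OF w(1)] w by simp
      next
        case False
        then have [simp]: "x = m" using q(1) by simp
        obtain r where r: "?w = msmul C r (\<i> m)" using smul_sc[OF simple_m w(1)] w by auto
        have "msmul C r g = g \<cdot> ?w" using g unfolding r by (simp add: comp_linear)
        also have "\<dots> = (g \<cdot> n) \<cdot> \<iota> i \<cdot> q" using g n \<iota>i q(2-4) by simp
        also have "\<dots> = mzero C m E" using gn \<iota>i q(2-4) y by simp
        finally have rg: "msmul C r g = mzero C m E" .
        have "r = 0"
        proof (rule vspace_smul_inject[OF vspace_Hom[of m E], where v=g])
          show "msmul C r g = msmul C 0 g" using rg g by simp
        qed (use g g0 in \<open>simp_all add: Hom_iff\<close>)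
        then show ?thesis using r by simp
      qed
      moreover have "n \<cdot> \<iota> i = ?w \<cdot> q'"
        using n \<iota>i q by simp
      ultimately show "n \<cdot> \<iota> i = mzero C (xs ! i) (cd n)" using q n w by (simp add: arr_obj)
    qed
    then show "h = h'" using eq_if_diff_zero[of h h'] h n by (simp add: n_def)
  qed
  then have "is_iso C m E g" using simple_unit simple_m by (auto simp: simple_def)
  then obtain h where h: "arr h" "dm h = E" "cd h = m" "h \<cdot> g = \<i> m"
    unfolding is_iso_def by (auto simp: Hom_iff)
  have "\<i> m = mzero C E m \<cdot> g" using h Hom_unit_m[OF h(1-3)] by simp
  then show False using g simple_m by (simp add: simple_def)
qed

end

section \<open>Column sums of the block matrices\<close>

lemma sum_spread:
  "(\<Sum>v\<in>ixs k. spread A v None * F v) = F None"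
  "i < k \<Longrightarrow> (\<Sum>v\<in>ixs k. spread A v (Some (i, j)) * F v) = (\<Sum>l<k. A l j * F (Some (i, l)))"
proof -
  have "(\<Sum>v\<in>ixs k. spread A v None * F v) = (\<Sum>v\<in>{None}. spread A v None * F v)"
    by (rule sum.mono_neutral_right) (auto simp: ixs_def)
  then show "(\<Sum>v\<in>ixs k. spread A v None * F v) = F None" by simp
  assume "i < k"
  then have "(\<Sum>v\<in>ixs k. spread A v (Some (i, j)) * F v) = (\<Sum>v\<in>(\<lambda>l. Some (i, l)) ` {..<k}. spread A v (Some (i, j)) * F v)"
    by (intro sum.mono_neutral_right) (auto simp: ixs_def)
  then show "(\<Sum>v\<in>ixs k. spread A v (Some (i, j)) * F v) = (\<Sum>l<k. A l j * F (Some (i, l)))"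
    by (simp add: sum.reindex inj_on_def)
qed

lemma sum_outer:
  "h < k \<Longrightarrow> (\<Sum>v\<in>jxs k. outer A B v (Inl (b, h)) * F v) = (\<Sum>a\<in>ixs k. B a b * F (Inl (a, h)))"
  "(\<Sum>v\<in>jxs k. outer A B v (Inr i) * F v) = (\<Sum>j<k. A j i * F (Inr j))"
proof -
  assume "h < k"
  then have "(\<Sum>v\<in>jxs k. outer A B v (Inl (b, h)) * F v)
      = (\<Sum>v\<in>(\<lambda>a. Inl (a, h)) ` ixs k. outer A B v (Inl (b, h)) * F v)"
    by (intro sum.mono_neutral_right) (auto simp: jxs_def)
  then show "(\<Sum>v\<in>jxs k. outer A B v (Inl (b, h)) * F v) = (\<Sum>a\<in>ixs k. B a b * F (Inl (a, h)))"
    by (simp add: sum.reindex inj_on_def)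
next
  have "(\<Sum>v\<in>jxs k. outer A B v (Inr i) * F v) = (\<Sum>v\<in>Inr ` {..<k}. outer A B v (Inr i) * F v)"
    by (rule sum.mono_neutral_right) (auto simp: jxs_def)
  then show "(\<Sum>v\<in>jxs k. outer A B v (Inr i) * F v) = (\<Sum>j<k. A j i * F (Inr j))"
    by (simp add: sum.reindex)
qed

lemma sum_inner:
  "h < k \<Longrightarrow> (\<Sum>v\<in>jxs k. inner B v (Inl (None, h)) * F v) = F (Inl (None, h))"
  "i < k \<Longrightarrow> (\<Sum>v\<in>jxs k. inner B v (enc i b) * F v) = (\<Sum>a\<in>ixs k. B a b * F (enc i a))"
proof -
  assume h: "h < k"
  have "inner B v (Inl (None, h)) = 0" if "v \<noteq> Inl (None, h)" for v
    using that by (cases v rule: dec.cases) (simp_all add: inner_def)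
  then have "(\<Sum>v\<in>jxs k. inner B v (Inl (None, h)) * F v) = (\<Sum>v\<in>{Inl (None, h)}. inner B v (Inl (None, h)) * F v)"
    using h by (intro sum.mono_neutral_right) simp_all
  then show "(\<Sum>v\<in>jxs k. inner B v (Inl (None, h)) * F v) = F (Inl (None, h))" by (simp add: inner_def)
next
  assume i: "i < k"
  have z: "inner B v (enc i b) = 0" if "v \<in> jxs k" "v \<notin> enc i ` ixs k" for v
  proof (cases "dec v")
    case (Inr x)
    then obtain j a where x: "dec v = Inr (j, a)" by (cases x) auto
    then have v: "v = enc j a" by (simp only: dec_eq_Inr)
    then have "j \<noteq> i" using that by auto
    then show ?thesis using x by (simp add: inner_def)
  qed (simp add: inner_def)
  have "(\<Sum>v\<in>jxs k. inner B v (enc i b) * F v) = (\<Sum>v\<in>enc i ` ixs k. inner B v (enc i b) * F v)"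
    using i z by (intro sum.mono_neutral_right) auto
  then show "(\<Sum>v\<in>jxs k. inner B v (enc i b) * F v) = (\<Sum>a\<in>ixs k. B a b * F (enc i a))"
    by (simp add: sum.reindex[OF inj_enc] inner_def)
qed

lemma jxs_cases:
  assumes "u \<in> jxs k"
  obtains (unit) h where "u = Inl (None, h)" "h < k"
    | (enc) i b where "u = enc i b" "i < k" "b \<in> ixs k"
proof (cases "dec u")
  case (Inl h)
  then show ?thesis using assms unit[of h] by (simp add: dec_eq_Inl)
next
  case (Inr x)
  then obtain i b where "dec u = Inr (i, b)" by (cases x) auto
  then have "u = enc i b" by (simp only: dec_eq_Inr)
  then show ?thesis using assms enc[of i b] by simp
qed

text \<open>A splitting of m \<otimes> m: \<open>c\<close>, \<open>e\<close> for the unit summand,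
  \<open>f i\<close>, \<open>p i\<close> for the copies of \<open>m\<close>. The pair
  \<open>c\<close>, \<open>e\<close> comes from the direct sum and is not assumed to be a duality
  pairing. Completeness is stated through functionals.\<close>

locale near_group_basis = near_group_category C m k
  for C :: "('o, 'm, 'r::field) cat_data" and m :: 'o and k :: nat +
  fixes c e :: 'm and f p :: "nat \<Rightarrow> 'm"
  assumes c [simp]: "arr c" "dm c = E" "cd c = m \<diamondop> m"
    and e [simp]: "arr e" "dm e = m \<diamondop> m" "cd e = E"
    and f [simp]: "i < k \<Longrightarrow> arr (f i)" "i < k \<Longrightarrow> dm (f i) = m" "i < k \<Longrightarrow> cd (f i) = m \<diamondop> m"
    and p [simp]: "i < k \<Longrightarrow> arr (p i)" "i < k \<Longrightarrow> dm (p i) = m \<diamondop> m" "i < k \<Longrightarrow> cd (p i) = m"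
    and ec: "e \<cdot> c = \<i> E"
    and pf: "i < k \<Longrightarrow> j < k \<Longrightarrow> p i \<cdot> f j = (if i = j then \<i> m else mzero C m m)"
    and ident_mm: "linfun (m \<diamondop> m) (m \<diamondop> m) \<l> \<Longrightarrow> \<l> (\<i> (m \<diamondop> m)) = \<l> (c \<cdot> e) + (\<Sum>i<k. \<l> (f i \<cdot> p i))"
begin

lemma ef: "i < k \<Longrightarrow> e \<cdot> f i = mzero C m E"
  by (rule Hom_m_unit) simp_all

lemma pc: "i < k \<Longrightarrow> p i \<cdot> c = mzero C E m"
  by (rule Hom_unit_m) simp_all

text \<open>Tree bases for the two bracketings, \<open>lt\<close> and \<open>rt\<close> with root
  \<open>m\<close>, \<open>lc\<close> and \<open>rc\<close> with root the unit. In
  \<open>Some (i, j)\<close> the vertex \<open>j\<close> is at the root and \<open>i\<close> above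
  it. \<open>rd\<close> is the basis dual to \<open>rt\<close>.\<close>

definition lt :: "ix \<Rightarrow> 'm" where
  "lt b = (case b of None \<Rightarrow> (c \<star> \<i> m) \<cdot> li m | Some (i, j) \<Rightarrow> (f i \<star> \<i> m) \<cdot> f j)"
definition rt :: "ix \<Rightarrow> 'm" where
  "rt b = (case b of None \<Rightarrow> (\<i> m \<star> c) \<cdot> ri m | Some (i, j) \<Rightarrow> (\<i> m \<star> f i) \<cdot> f j)"
definition rd :: "ix \<Rightarrow> 'm" where
  "rd b = (case b of None \<Rightarrow> ru C m \<cdot> (\<i> m \<star> e) | Some (i, j) \<Rightarrow> p j \<cdot> (\<i> m \<star> p i))"
definition lc :: "nat \<Rightarrow> 'm" where "lc i = (f i \<star> \<i> m) \<cdot> c"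
definition rc :: "nat \<Rightarrow> 'm" where "rc i = (\<i> m \<star> f i) \<cdot> c"

lemma ixs_cases:
  assumes "b \<in> ixs k"
  obtains "b = None" | i j where "b = Some (i, j)" "i < k" "j < k"
  using assms by (auto simp: ixs_def)

lemma trees [simp]:
  assumes "b \<in> ixs k"
  shows "arr (lt b)" "dm (lt b) = m" "cd (lt b) = (m \<diamondop> m) \<diamondop> m"
    "arr (rt b)" "dm (rt b) = m" "cd (rt b) = m \<diamondop> (m \<diamondop> m)"
    "arr (rd b)" "dm (rd b) = m \<diamondop> (m \<diamondop> m)" "cd (rd b) = m"
  by (rule ixs_cases[OF assms]; simp add: lt_def rt_def rd_def)+

lemma trees_unit [simp]:
  assumes "i < k"
  shows "arr (lc i)" "dm (lc i) = E" "cd (lc i) = (m \<diamondop> m) \<diamondop> m"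
    "arr (rc i)" "dm (rc i) = E" "cd (rc i) = m \<diamondop> (m \<diamondop> m)"
  using assms by (simp_all add: lc_def rc_def)

text \<open>The coefficient of \<open>rc j\<close> in the image of \<open>lc i\<close>: composing
  with \<open>p j\<close> and then \<open>e\<close> is dual to \<open>rc j\<close>.\<close>

definition Am :: "nat \<Rightarrow> nat \<Rightarrow> 'r" where
  "Am j i = sc E (e \<cdot> (\<i> m \<star> p j) \<cdot> \<a> m m m \<cdot> lc i)"
definition Bm :: "ix \<Rightarrow> ix \<Rightarrow> 'r" where
  "Bm a b = sc m (rd a \<cdot> \<a> m m m \<cdot> lt b)"

lemma expand_mm:
  assumes g: "arr g" "dm g = x" "cd g = m \<diamondop> m" and l: "linfun x (m \<diamondop> m) \<l>"
  shows "\<l> g = \<l> (c \<cdot> e \<cdot> g) + (\<Sum>i<k. \<l> (f i \<cdot> p i \<cdot> g))"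
proof -
  have "linfun (m \<diamondop> m) (m \<diamondop> m) (\<lambda>z. \<l> (z \<cdot> g))" using linfun_comp_right[OF l g] by simp
  from ident_mm[OF this] show ?thesis using g by simp
qed

lemma expand_mmm:
  assumes g: "arr g" "dm g = x" "cd g = m \<diamondop> (m \<diamondop> m)" and l: "linfun x (m \<diamondop> (m \<diamondop> m)) \<l>"
  shows "\<l> g = \<l> ((\<i> m \<star> c) \<cdot> (\<i> m \<star> e) \<cdot> g) + (\<Sum>i<k. \<l> ((\<i> m \<star> f i) \<cdot> (\<i> m \<star> p i) \<cdot> g))"
proof -
  have "linfun (m \<diamondop> (m \<diamondop> m)) (m \<diamondop> (m \<diamondop> m)) (\<lambda>z. \<l> (z \<cdot> g))" using linfun_comp_right[OF l g] by simp
  then have "linfun (m \<diamondop> m) (m \<diamondop> m) (\<lambda>z. \<l> ((\<i> m \<star> z) \<cdot> g))"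
    by (intro linfun_tensor_right[of "\<i> m" _ _ "\<lambda>z. \<l> (z \<cdot> g)"]) simp_all
  from ident_mm[OF this] show ?thesis using g by (simp add: interchange_comp)
qed

text \<open>The identity of m \<otimes> m is resolved in the right factor and then once more. Arrows
  from \<open>m\<close> to \<open>E\<close> vanish, and what remains are endomorphisms of
  \<open>m\<close>, hence scalars. The arrow \<open>G\<close> is carried along for use inside larger
  composites.\<close>

lemma expand_lt:
  assumes b: "b \<in> ixs k" and l: "linfun m (cd G) \<l>" and G: "arr G" "dm G = m \<diamondop> (m \<diamondop> m)"
  shows "\<l> (G \<cdot> \<a> m m m \<cdot> lt b) = (\<Sum>a\<in>ixs k. Bm a b * \<l> (G \<cdot> rt a))"
proof -
  let ?g = "\<a> m m m \<cdot> lt b"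
  have g: "arr ?g" "dm ?g = m" "cd ?g = m \<diamondop> (m \<diamondop> m)" using b by simp_all
  define l' where "l' = (\<lambda>g. \<l> (G \<cdot> g))"
  have l': "linfun m (m \<diamondop> (m \<diamondop> m)) l'" unfolding l'_def using l G by (intro linfun_comp) simp_all
  have "l' ((\<i> m \<star> c) \<cdot> (\<i> m \<star> e) \<cdot> ?g) = Bm None b * l' (rt None)"
  proof -
    \<comment> \<open>Inserting the right unitor and its inverse produces an endomorphism of
      \<open>m\<close>, to which Schur's lemma applies.\<close>
    have "(\<i> m \<star> e) \<cdot> ?g = (ri m \<cdot> ru C m) \<cdot> (\<i> m \<star> e) \<cdot> ?g" using g by simp
    also have "\<dots> = ri m \<cdot> (rd None \<cdot> ?g)" using g by (simp add: rd_def del: unitor_inv(9))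
    also have "rd None \<cdot> ?g = msmul C (Bm None b) (\<i> m)"
      unfolding Bm_def using g by (intro smul_sc simple_m) simp_all
    finally have "(\<i> m \<star> c) \<cdot> (\<i> m \<star> e) \<cdot> ?g = msmul C (Bm None b) (rt None)"
      by (simp add: comp_linear rt_def)
    then show ?thesis using linfun_smul[OF l', of "rt None"] by simp
  qed
  moreover have "l' ((\<i> m \<star> f i) \<cdot> (\<i> m \<star> p i) \<cdot> ?g) = (\<Sum>j<k. Bm (Some (i, j)) b * l' (rt (Some (i, j))))"
    if i: "i < k" for i
  proof -
    let ?h = "(\<i> m \<star> p i) \<cdot> ?g"
    have h: "arr ?h" "dm ?h = m" "cd ?h = m \<diamondop> m" using i g by simp_all
    have l2: "linfun m (m \<diamondop> m) (\<lambda>g. l' ((\<i> m \<star> f i) \<cdot> g))"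
      using i by (intro linfun_comp[OF l']) simp_all
    have "e \<cdot> ?h = mzero C m E" by (rule Hom_m_unit) (use h in simp_all)
    then have "(\<i> m \<star> f i) \<cdot> c \<cdot> e \<cdot> ?h = mzero C m (m \<diamondop> (m \<diamondop> m))" using i by simp
    then have z: "l' ((\<i> m \<star> f i) \<cdot> c \<cdot> e \<cdot> ?h) = 0" using linfun_zero[OF l'] by simp
    have "l' ((\<i> m \<star> f i) \<cdot> f j \<cdot> p j \<cdot> ?h) = Bm (Some (i, j)) b * l' (rt (Some (i, j)))" if j: "j < k" for j
    proof -
      have "p j \<cdot> ?h = rd (Some (i, j)) \<cdot> ?g" using i j g by (simp add: rd_def)
      also have "\<dots> = msmul C (Bm (Some (i, j)) b) (\<i> m)"
        unfolding Bm_def using i j g by (intro smul_sc simple_m) simp_all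
      finally have "(\<i> m \<star> f i) \<cdot> f j \<cdot> p j \<cdot> ?h = msmul C (Bm (Some (i, j)) b) (rt (Some (i, j)))"
        using i j by (simp add: comp_linear rt_def)
      then show ?thesis using linfun_smul[OF l', of "rt (Some (i, j))"] i j by simp
    qed
    then show ?thesis using expand_mm[OF h l2] z by simp
  qed
  ultimately have "l' ?g = Bm None b * l' (rt None) + (\<Sum>i<k. \<Sum>j<k. Bm (Some (i, j)) b * l' (rt (Some (i, j))))"
    using expand_mmm[OF g l'] by simp
  also have "(\<Sum>i<k. \<Sum>j<k. Bm (Some (i, j)) b * l' (rt (Some (i, j))))
      = (\<Sum>x\<in>{..<k}\<times>{..<k}. Bm (Some x) b * l' (rt (Some x)))"
    unfolding sum.cartesian_product by (rule sum.cong) auto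
  also have "Bm None b * l' (rt None) + \<dots> = (\<Sum>a\<in>ixs k. Bm a b * l' (rt a))"
    unfolding ixs_def by (subst sum.insert) (auto simp: sum.reindex)
  finally show ?thesis by (simp add: l'_def)
qed

text \<open>As for \<open>lt\<close>, but with root \<open>E\<close> the unit channel of the first
  resolution yields an arrow from \<open>E\<close> to \<open>m\<close> and drops out; hence there is
  no label \<open>None\<close> here.\<close>

lemma expand_lc:
  assumes n: "n < k" and l: "linfun E (cd G) \<l>" and G: "arr G" "dm G = m \<diamondop> (m \<diamondop> m)"
  shows "\<l> (G \<cdot> \<a> m m m \<cdot> lc n) = (\<Sum>i<k. Am i n * \<l> (G \<cdot> rc i))"
proof -
  let ?g = "\<a> m m m \<cdot> lc n"
  have g: "arr ?g" "dm ?g = E" "cd ?g = m \<diamondop> (m \<diamondop> m)" using n by simp_all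
  define l' where "l' = (\<lambda>g. \<l> (G \<cdot> g))"
  have l': "linfun E (m \<diamondop> (m \<diamondop> m)) l'" unfolding l'_def using l G by (intro linfun_comp) simp_all
  have "l' ((\<i> m \<star> c) \<cdot> (\<i> m \<star> e) \<cdot> ?g) = 0"
  proof -
    have "(\<i> m \<star> e) \<cdot> ?g = (ri m \<cdot> ru C m) \<cdot> (\<i> m \<star> e) \<cdot> ?g" using g by simp
    also have "\<dots> = ri m \<cdot> (ru C m \<cdot> (\<i> m \<star> e) \<cdot> ?g)" using g by (simp del: unitor_inv(9))
    also have "ru C m \<cdot> (\<i> m \<star> e) \<cdot> ?g = mzero C E m" by (rule Hom_unit_m) (use g in simp_all)
    finally have "(\<i> m \<star> c) \<cdot> (\<i> m \<star> e) \<cdot> ?g = mzero C E (m \<diamondop> (m \<diamondop> m))" by simp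
    then show ?thesis using linfun_zero[OF l'] by simp
  qed
  moreover have "l' ((\<i> m \<star> f i) \<cdot> (\<i> m \<star> p i) \<cdot> ?g) = Am i n * l' (rc i)" if i: "i < k" for i
  proof -
    let ?h = "(\<i> m \<star> p i) \<cdot> ?g"
    have h: "arr ?h" "dm ?h = E" "cd ?h = m \<diamondop> m" using i g by simp_all
    have l2: "linfun E (m \<diamondop> m) (\<lambda>g. l' ((\<i> m \<star> f i) \<cdot> g))"
      using i by (intro linfun_comp[OF l']) simp_all
    have "l' ((\<i> m \<star> f i) \<cdot> f j \<cdot> p j \<cdot> ?h) = 0" if j: "j < k" for j
    proof -
      have "p j \<cdot> ?h = mzero C E m" by (rule Hom_unit_m) (use h j in simp_all)
      then have "(\<i> m \<star> f i) \<cdot> f j \<cdot> p j \<cdot> ?h = mzero C E (m \<diamondop> (m \<diamondop> m))" using i j by simp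
      then show ?thesis using linfun_zero[OF l'] by simp
    qed
    moreover have "e \<cdot> ?h = msmul C (Am i n) (\<i> E)"
      unfolding Am_def using h by (intro smul_sc simple_unit) simp_all
    then have "(\<i> m \<star> f i) \<cdot> c \<cdot> e \<cdot> ?h = msmul C (Am i n) (rc i)"
      using i by (simp add: comp_linear rc_def)
    then have "l' ((\<i> m \<star> f i) \<cdot> c \<cdot> e \<cdot> ?h) = Am i n * l' (rc i)"
      using linfun_smul[OF l', of "rc i"] i by simp
    ultimately show ?thesis using expand_mm[OF h l2] by simp
  qed
  ultimately have "l' ?g = (\<Sum>i<k. Am i n * l' (rc i))"
    using expand_mmm[OF g l'] by simp
  then show ?thesis by (simp add: l'_def)
qed

text \<open>A unit vertex in the middle slot passes the associator with coefficient 1. The next two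
  lemmas do the same for the outer slots.\<close>

lemma mid_None:
  assumes t: "arr t" "cd t = m \<diamondop> m"
  shows "\<a> m (m \<diamondop> m) m \<cdot> (rt None \<star> \<i> m) \<cdot> t = (\<i> m \<star> lt None) \<cdot> t"
proof -
  have "\<a> m (m \<diamondop> m) m \<cdot> (rt None \<star> \<i> m) \<cdot> t = (\<i> m \<star> (c \<star> \<i> m)) \<cdot> \<a> m E m \<cdot> (ri m \<star> \<i> m) \<cdot> t"
    using t unfolding rt_def by (simp add: assoc_comp_mid)
  also have "\<dots> = (\<i> m \<star> (c \<star> \<i> m)) \<cdot> (\<a> m E m \<cdot> (ri m \<star> \<i> m)) \<cdot> t" using t by simp
  also have "\<dots> = (\<i> m \<star> (c \<star> \<i> m)) \<cdot> (\<i> m \<star> li m) \<cdot> t" by (simp only: assoc_unitor_inv m_obj)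
  also have "\<dots> = (\<i> m \<star> lt None) \<cdot> t" using t by (simp add: interchange_comp lt_def)
  finally show ?thesis .
qed

lemma left_None:
  assumes t: "arr t" "dm t = x" "cd t = m \<diamondop> m"
  shows "\<a> (m \<diamondop> m) m m \<cdot> (lt None \<star> \<i> m) \<cdot> t = (c \<star> t) \<cdot> li x"
proof -
  have x: "x \<in> Obj C" using arr_obj[OF t(1)] t by simp
  have "\<a> (m \<diamondop> m) m m \<cdot> (lt None \<star> \<i> m) \<cdot> t = (c \<star> \<i> (m \<diamondop> m)) \<cdot> \<a> E m m \<cdot> (li m \<star> \<i> m) \<cdot> t"
    using t unfolding lt_def by (simp add: assoc_comp_left)
  also have "\<dots> = (c \<star> \<i> (m \<diamondop> m)) \<cdot> (\<a> E m m \<cdot> (li m \<star> \<i> m)) \<cdot> t" using t by simp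
  also have "\<dots> = (c \<star> \<i> (m \<diamondop> m)) \<cdot> li (m \<diamondop> m) \<cdot> t" by (simp only: assoc_unitor_inv m_obj)
  also have "li (m \<diamondop> m) \<cdot> t = (\<i> E \<star> t) \<cdot> li x" using unitor_inv_natural(1)[OF t(1)] t by simp
  also have "(c \<star> \<i> (m \<diamondop> m)) \<cdot> (\<i> E \<star> t) \<cdot> li x = (c \<star> t) \<cdot> li x" using t x by (simp add: interchange_comp)
  finally show ?thesis .
qed

lemma right_None:
  assumes g: "arr g" "dm g = x" "cd g = m \<diamondop> m"
  shows "\<a> m m (m \<diamondop> m) \<cdot> (g \<star> c) \<cdot> ri x = (\<i> m \<star> rt None) \<cdot> g"
proof -
  have x: "x \<in> Obj C" using arr_obj[OF g(1)] g by simp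
  have "\<a> m m (m \<diamondop> m) \<cdot> (g \<star> c) \<cdot> ri x = (\<i> m \<star> (\<i> m \<star> c)) \<cdot> \<a> m m E \<cdot> (g \<star> \<i> E) \<cdot> ri x"
    using g x assoc_comp_right[of g c "ri x"] by simp
  also have "(g \<star> \<i> E) \<cdot> ri x = ri (m \<diamondop> m) \<cdot> g" using unitor_inv_natural(2)[OF g(1)] g by simp
  also have "\<a> m m E \<cdot> ri (m \<diamondop> m) \<cdot> g = (\<a> m m E \<cdot> ri (m \<diamondop> m)) \<cdot> g" using g by simp
  also have "\<dots> = (\<i> m \<star> ri m) \<cdot> g" by (simp only: assoc_unitor_inv m_obj)
  also have "(\<i> m \<star> (\<i> m \<star> c)) \<cdot> (\<i> m \<star> ri m) \<cdot> g = (\<i> m \<star> rt None) \<cdot> g"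
    using g by (simp add: interchange_comp rt_def)
  finally show ?thesis .
qed

end

section \<open>The pentagon on arrows out of the unit\<close>

context near_group_basis
begin

fun mt :: "ix \<Rightarrow> 'm" where
  "mt None = (c \<star> c) \<cdot> li E"
| "mt (Some (i, j)) = (f i \<star> f j) \<cdot> c"

lemma rep_whisker_left:
  assumes t: "arr t" "cd t = m \<diamondop> m" and x: "dm t = x"
  shows "rep x (\<a> m m m \<star> \<i> m) (ixs k) (\<lambda>b. (lt b \<star> \<i> m) \<cdot> t) (\<lambda>b. (rt b \<star> \<i> m) \<cdot> t) Bm"
  unfolding rep_def
proof (intro ballI allI impI)
  fix b \<l> assume b: "b \<in> ixs k" and "linfun x (cd (\<a> m m m \<star> \<i> m)) \<l>"
  then have "linfun (m \<diamondop> m) ((m \<diamondop> (m \<diamondop> m)) \<diamondop> m) (\<lambda>g. \<l> (g \<cdot> t))"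
    using t x by (intro linfun_comp_right) simp_all
  then have "linfun m (cd (\<i> (m \<diamondop> (m \<diamondop> m)))) (\<lambda>g. \<l> ((g \<star> \<i> m) \<cdot> t))"
    using linfun_tensor_left[of m "\<i> m" "m \<diamondop> (m \<diamondop> m)" "\<lambda>g. \<l> (g \<cdot> t)"] by simp
  from expand_lt[OF b this] show "\<l> ((\<a> m m m \<star> \<i> m) \<cdot> (lt b \<star> \<i> m) \<cdot> t) = (\<Sum>a\<in>ixs k. Bm a b * \<l> ((rt a \<star> \<i> m) \<cdot> t))"
    using b t by (simp add: interchange_comp)
qed

lemma rep_whisker_right:
  assumes t: "arr t" "cd t = m \<diamondop> m" and x: "dm t = x"
  shows "rep x (\<i> m \<star> \<a> m m m) (ixs k) (\<lambda>b. (\<i> m \<star> lt b) \<cdot> t) (\<lambda>b. (\<i> m \<star> rt b) \<cdot> t) Bm"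
  unfolding rep_def
proof (intro ballI allI impI)
  fix b \<l> assume b: "b \<in> ixs k" and "linfun x (cd (\<i> m \<star> \<a> m m m)) \<l>"
  then have "linfun (m \<diamondop> m) (m \<diamondop> (m \<diamondop> (m \<diamondop> m))) (\<lambda>g. \<l> (g \<cdot> t))"
    using t x by (intro linfun_comp_right) simp_all
  then have "linfun m (cd (\<i> (m \<diamondop> (m \<diamondop> m)))) (\<lambda>g. \<l> ((\<i> m \<star> g) \<cdot> t))"
    using linfun_tensor_right[of "\<i> m" m "m \<diamondop> (m \<diamondop> m)" "\<lambda>g. \<l> (g \<cdot> t)"] by simp
  from expand_lt[OF b this] show "\<l> ((\<i> m \<star> \<a> m m m) \<cdot> (\<i> m \<star> lt b) \<cdot> t) = (\<Sum>a\<in>ixs k. Bm a b * \<l> ((\<i> m \<star> rt a) \<cdot> t))"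
    using b t by (simp add: interchange_comp)
qed

lemma rep_unit_mid:
  "rep E (\<a> m (m \<diamondop> m) m) (ixs k) (\<lambda>b. (rt b \<star> \<i> m) \<cdot> c) (\<lambda>b. (\<i> m \<star> lt b) \<cdot> c) (spread Am)"
  unfolding rep_def
proof (intro ballI allI impI)
  fix b \<l> assume b: "b \<in> ixs k" and l: "linfun E (cd (\<a> m (m \<diamondop> m) m)) \<l>"
  from b show "\<l> (\<a> m (m \<diamondop> m) m \<cdot> (rt b \<star> \<i> m) \<cdot> c) = (\<Sum>v\<in>ixs k. spread Am v b * \<l> ((\<i> m \<star> lt v) \<cdot> c))"
  proof (cases rule: ixs_cases)
    case 1
    then show ?thesis by (simp add: mid_None sum_spread)
  next
    case (2 i j)
    have "\<a> m (m \<diamondop> m) m \<cdot> (rt b \<star> \<i> m) \<cdot> c = (\<i> m \<star> (f i \<star> \<i> m)) \<cdot> \<a> m m m \<cdot> lc j"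
      using 2 assoc_comp_mid[of "f i" "f j" c m m] by (simp add: rt_def lc_def)
    moreover have "(\<i> m \<star> (f i \<star> \<i> m)) \<cdot> rc l = (\<i> m \<star> lt (Some (i, l))) \<cdot> c" if "l < k" for l
      using that 2 by (simp add: rc_def lt_def interchange_comp)
    ultimately show ?thesis
      using expand_lc[of j "\<i> m \<star> (f i \<star> \<i> m)" \<l>] l 2 by (simp add: sum_spread)
  qed
qed

lemma rep_unit_left:
  "rep E (\<a> (m \<diamondop> m) m m) (ixs k) (\<lambda>b. (lt b \<star> \<i> m) \<cdot> c) mt (spread Am)"
  unfolding rep_def
proof (intro ballI allI impI)
  fix b \<l> assume b: "b \<in> ixs k" and l: "linfun E (cd (\<a> (m \<diamondop> m) m m)) \<l>"
  from b show "\<l> (\<a> (m \<diamondop> m) m m \<cdot> (lt b \<star> \<i> m) \<cdot> c) = (\<Sum>v\<in>ixs k. spread Am v b * \<l> (mt v))"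
  proof (cases rule: ixs_cases)
    case 1
    then show ?thesis by (simp add: left_None[of _ E] sum_spread)
  next
    case (2 i j)
    have "\<a> (m \<diamondop> m) m m \<cdot> (lt b \<star> \<i> m) \<cdot> c = (f i \<star> \<i> (m \<diamondop> m)) \<cdot> \<a> m m m \<cdot> lc j"
      using 2 assoc_comp_left[of "f i" "f j" c m m] by (simp add: lt_def lc_def)
    moreover have "(f i \<star> \<i> (m \<diamondop> m)) \<cdot> rc l = mt (Some (i, l))" if "l < k" for l
      using that 2 by (simp add: rc_def interchange_comp)
    ultimately show ?thesis
      using expand_lc[of j "f i \<star> \<i> (m \<diamondop> m)" \<l>] l 2 by (simp add: sum_spread)
  qed
qed

text \<open>Here the vertex of the right factor, \<open>f j\<close>, is inert, so \<open>j\<close>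
  becomes the first index of the resulting label. This is where \<open>flip2\<close>, and with it
  the sign, arises.\<close>

lemma rep_unit_right:
  "rep E (\<a> m m (m \<diamondop> m)) (ixs k) mt (\<lambda>b. (\<i> m \<star> rt b) \<cdot> c) (\<lambda>u v. spread Am u (flip2 v))"
  unfolding rep_def
proof (intro ballI allI impI)
  fix b \<l> assume b: "b \<in> ixs k" and l: "linfun E (cd (\<a> m m (m \<diamondop> m))) \<l>"
  from b show "\<l> (\<a> m m (m \<diamondop> m) \<cdot> mt b) = (\<Sum>v\<in>ixs k. spread Am v (flip2 b) * \<l> ((\<i> m \<star> rt v) \<cdot> c))"
  proof (cases rule: ixs_cases)
    case 1
    then show ?thesis by (simp add: li_unit right_None[of _ E] sum_spread)
  next
    case (2 i j)
    have "\<a> m m (m \<diamondop> m) \<cdot> mt b = (\<i> m \<star> (\<i> m \<star> f j)) \<cdot> \<a> m m m \<cdot> lc i"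
      using 2 assoc_comp_right[of "f i" "f j" c m m] by (simp add: lc_def)
    moreover have "(\<i> m \<star> (\<i> m \<star> f j)) \<cdot> rc l = (\<i> m \<star> rt (Some (j, l))) \<cdot> c" if "l < k" for l
      using that 2 by (simp add: rc_def rt_def interchange_comp)
    ultimately show ?thesis
      using expand_lc[of i "\<i> m \<star> (\<i> m \<star> f j)" \<l>] l 2 by (simp add: sum_spread)
  qed
qed

lemma mt_arr [simp]:
  assumes "b \<in> ixs k"
  shows "arr (mt b)" "dm (mt b) = E" "cd (mt b) = (m \<diamondop> m) \<diamondop> (m \<diamondop> m)"
  by (rule ixs_cases[OF assms]; simp)+

lemma rd_rt: 
  assumes a: "a \<in> ixs k" and b: "b \<in> ixs k"
  shows "rd a \<cdot> rt b = (if a = b then \<i> m else mzero C m m)"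
proof (cases rule: ixs_cases[OF a]; cases rule: ixs_cases[OF b])
  assume [simp]: "a = None" "b = None"
  have "rd a \<cdot> rt b = ru C m \<cdot> (\<i> m \<star> (e \<cdot> c)) \<cdot> ri m" by (simp add: rd_def rt_def interchange_comp)
  then show ?thesis by (simp add: ec)
next
  fix i j assume [simp]: "a = None" "b = Some (i, j)" "i < k" "j < k"
  have "rd a \<cdot> rt b = ru C m \<cdot> (\<i> m \<star> (e \<cdot> f i)) \<cdot> f j" by (simp add: rd_def rt_def interchange_comp)
  then show ?thesis by (simp add: ef)
next
  fix i j assume [simp]: "b = None" "a = Some (i, j)" "i < k" "j < k"
  have "rd a \<cdot> rt b = p j \<cdot> (\<i> m \<star> (p i \<cdot> c)) \<cdot> ri m" by (simp add: rd_def rt_def interchange_comp)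
  then show ?thesis by (simp add: pc)
next
  fix i j i' j' assume [simp]: "a = Some (i, j)" "i < k" "j < k" "b = Some (i', j')" "i' < k" "j' < k"
  have "rd a \<cdot> rt b = p j \<cdot> (\<i> m \<star> (p i \<cdot> f i')) \<cdot> f j'" by (simp add: rd_def rt_def interchange_comp)
  then show ?thesis by (simp add: pf)
qed

text \<open>Both sides of the pentagon carry the same trees to the same trees, so their matrices
  agree. The functional built from \<open>e\<close> and \<open>rd u\<close> is dual to the target
  tree \<open>u\<close>.\<close>

lemma pentagon_unit:
  assumes "u \<in> ixs k" "v \<in> ixs k"
  shows "mmul (ixs k) Bm (mmul (ixs k) (spread Am) Bm) u v
    = mmul (ixs k) (\<lambda>u v. spread Am u (flip2 v)) (spread Am) u v"
proof -
  let ?T = "\<lambda>b. (lt b \<star> \<i> m) \<cdot> c" and ?R = "\<lambda>b. (\<i> m \<star> rt b) \<cdot> c"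
  let ?P = "(\<i> m \<star> \<a> m m m) \<cdot> \<a> m (m \<diamondop> m) m \<cdot> (\<a> m m m \<star> \<i> m)"
  have r1: "rep E ?P (ixs k) ?T ?R (mmul (ixs k) Bm (mmul (ixs k) (spread Am) Bm))"
    by (intro rep_comp[OF rep_comp[OF rep_whisker_left rep_unit_mid] rep_whisker_right]) simp_all
  have "rep E (\<a> m m (m \<diamondop> m) \<cdot> \<a> (m \<diamondop> m) m m) (ixs k) ?T ?R (mmul (ixs k) (\<lambda>u v. spread Am u (flip2 v)) (spread Am))"
    by (intro rep_comp[OF rep_unit_left rep_unit_right]) simp_all
  then have r2: "rep E ?P (ixs k) ?T ?R (mmul (ixs k) (\<lambda>u v. spread Am u (flip2 v)) (spread Am))"
    by (simp only: pentagon m_obj)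
  let ?l = "\<lambda>g. sc E (e \<cdot> (\<i> m \<star> rd u) \<cdot> g)"
  have "linfun E (m \<diamondop> m) (\<lambda>g. sc E (e \<cdot> g))" by (rule linfun_comp[OF linfun_sc[OF simple_unit]]) simp_all
  then have l: "linfun E (cd ?P) ?l"
    using assms by (intro linfun_comp[of _ _ "\<lambda>g. sc E (e \<cdot> g)"]) simp_all
  have d: "?l (?R w) = (if w = u then 1 else 0)" if w: "w \<in> ixs k" for w
  proof -
    have "e \<cdot> (\<i> m \<star> rd u) \<cdot> ?R w = e \<cdot> (\<i> m \<star> (rd u \<cdot> rt w)) \<cdot> c"
      using assms w by (simp add: interchange_comp)
    also have "\<dots> = (if w = u then \<i> E else mzero C E E)"
      using assms w by (simp add: rd_rt ec)
    finally show ?thesis using linfun_zero[OF linfun_sc[OF simple_unit]] by (simp add: sc_ident[OF simple_unit])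
  qed
  show ?thesis by (rule rep_unique[OF r1 r2 _ assms(2,1) l d]) simp
qed

section \<open>The pentagon on arrows out of \<open>m\<close>: tree bases for the five bracketings
  of four factors\<close>

fun T0 :: "ix \<times> nat + nat \<Rightarrow> 'm" where
  "T0 (Inl (b, h)) = (lt b \<star> \<i> m) \<cdot> f h" | "T0 (Inr i) = (lc i \<star> \<i> m) \<cdot> li m"
fun T1 :: "ix \<times> nat + nat \<Rightarrow> 'm" where
  "T1 (Inl (b, h)) = (rt b \<star> \<i> m) \<cdot> f h" | "T1 (Inr i) = (rc i \<star> \<i> m) \<cdot> li m"
fun T2 :: "ix \<times> nat + nat \<Rightarrow> 'm" where
  "T2 (Inl (b, h)) = (\<i> m \<star> lt b) \<cdot> f h" | "T2 (Inr i) = (\<i> m \<star> lc i) \<cdot> ri m"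
fun T3 :: "ix \<times> nat + nat \<Rightarrow> 'm" where
  "T3 (Inl (b, h)) = (\<i> m \<star> rt b) \<cdot> f h" | "T3 (Inr i) = (\<i> m \<star> rc i) \<cdot> ri m"
fun TM :: "ix \<times> nat + nat \<Rightarrow> 'm" where
  "TM (Inl (None, h)) = (c \<star> f h) \<cdot> li m"
| "TM (Inl (Some (i, j), h)) = (f i \<star> f j) \<cdot> f h"
| "TM (Inr i) = (f i \<star> c) \<cdot> ri m"

text \<open>The trees regrouped so that the vertex \<open>i\<close> nearest to the leaves is split
  off. What is left is a three-leaf tree, so these associators reduce to the one of
  \<open>m\<close>, \<open>m\<close>, \<open>m\<close>.\<close>

lemma T_enc:
  assumes "i < k" "b \<in> ixs k"
  shows "T2 (enc i b) = (\<i> m \<star> (f i \<star> \<i> m)) \<cdot> rt b"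
    "T3 (enc i b) = (\<i> m \<star> (\<i> m \<star> f i)) \<cdot> rt b"
    "TM (enc i b) = (f i \<star> \<i> (m \<diamondop> m)) \<cdot> rt b"
    "\<a> m (m \<diamondop> m) m \<cdot> T1 (enc i b) = (\<i> m \<star> (f i \<star> \<i> m)) \<cdot> \<a> m m m \<cdot> lt b"
    "\<a> (m \<diamondop> m) m m \<cdot> T0 (enc i b) = (f i \<star> \<i> (m \<diamondop> m)) \<cdot> \<a> m m m \<cdot> lt b"
  using assms(2)
  by (cases rule: ixs_cases; use assms(1) in \<open>simp add: rt_def lt_def lc_def rc_def interchange_comp
    assoc_comp_mid[of "f i" _ _ m m] assoc_comp_left[of "f i" _ _ m m]\<close>)+

lemma T_arr [simp]:
  assumes "u \<in> jxs k"
  shows "arr (T0 u)" "dm (T0 u) = m" "cd (T0 u) = ((m \<diamondop> m) \<diamondop> m) \<diamondop> m"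
  using assms by (cases u; force)+

lemma rep_outer_left: "rep m (\<a> m m m \<star> \<i> m) (jxs k) T0 T1 (outer Am Bm)"
  unfolding rep_def
proof (intro ballI allI impI)
  fix u \<l> assume u: "u \<in> jxs k" and l: "linfun m (cd (\<a> m m m \<star> \<i> m)) \<l>"
  show "\<l> ((\<a> m m m \<star> \<i> m) \<cdot> T0 u) = (\<Sum>v\<in>jxs k. outer Am Bm v u * \<l> (T1 v))"
  proof (cases u)
    case (Inl x)
    then obtain b h where x: "u = Inl (b, h)" "b \<in> ixs k" "h < k" using u by (cases x) simp
    from x rep_whisker_left[of "f h" m, unfolded rep_def, rule_format, OF _ _ _ x(2) l]
    show ?thesis by (simp add: sum_outer)
  next
    case (Inr i)
    then have i: "i < k" using u by simp
    have "linfun (E \<diamondop> m) ((m \<diamondop> (m \<diamondop> m)) \<diamondop> m) (\<lambda>g. \<l> (g \<cdot> li m))"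
      using l by (intro linfun_comp_right) simp_all
    then have "linfun E (cd (\<i> (m \<diamondop> (m \<diamondop> m)))) (\<lambda>g. \<l> ((g \<star> \<i> m) \<cdot> li m))"
      using linfun_tensor_left[of E "\<i> m" "m \<diamondop> (m \<diamondop> m)" "\<lambda>g. \<l> (g \<cdot> li m)"] by simp
    from expand_lc[OF i this] show ?thesis using i Inr by (simp add: interchange_comp sum_outer)
  qed
qed

lemma rep_outer_right: "rep m (\<i> m \<star> \<a> m m m) (jxs k) T2 T3 (outer Am Bm)"
  unfolding rep_def
proof (intro ballI allI impI)
  fix u \<l> assume u: "u \<in> jxs k" and l: "linfun m (cd (\<i> m \<star> \<a> m m m)) \<l>"
  show "\<l> ((\<i> m \<star> \<a> m m m) \<cdot> T2 u) = (\<Sum>v\<in>jxs k. outer Am Bm v u * \<l> (T3 v))"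
  proof (cases u)
    case (Inl x)
    then obtain b h where x: "u = Inl (b, h)" "b \<in> ixs k" "h < k" using u by (cases x) simp
    from x rep_whisker_right[of "f h" m, unfolded rep_def, rule_format, OF _ _ _ x(2) l]
    show ?thesis by (simp add: sum_outer)
  next
    case (Inr i)
    then have i: "i < k" using u by simp
    have "linfun (m \<diamondop> E) (m \<diamondop> (m \<diamondop> (m \<diamondop> m))) (\<lambda>g. \<l> (g \<cdot> ri m))"
      using l by (intro linfun_comp_right) simp_all
    then have "linfun E (cd (\<i> (m \<diamondop> (m \<diamondop> m)))) (\<lambda>g. \<l> ((\<i> m \<star> g) \<cdot> ri m))"
      using linfun_tensor_right[of "\<i> m" E "m \<diamondop> (m \<diamondop> m)" "\<lambda>g. \<l> (g \<cdot> ri m)"] by simp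
    from expand_lc[OF i this] show ?thesis using i Inr by (simp add: interchange_comp sum_outer)
  qed
qed

lemma rep_inner_mid: "rep m (\<a> m (m \<diamondop> m) m) (jxs k) T1 T2 (inner Bm)"
  unfolding rep_def
proof (intro ballI allI impI)
  fix u \<l> assume u: "u \<in> jxs k" and l: "linfun m (cd (\<a> m (m \<diamondop> m) m)) \<l>"
  from u show "\<l> (\<a> m (m \<diamondop> m) m \<cdot> T1 u) = (\<Sum>v\<in>jxs k. inner Bm v u * \<l> (T2 v))"
  proof (cases rule: jxs_cases)
    case (unit h)
    then show ?thesis by (simp add: sum_inner mid_None)
  next
    case (enc i b)
    then show ?thesis using expand_lt[of b "\<i> m \<star> (f i \<star> \<i> m)" \<l>] l
      by (simp add: sum_inner T_enc)
  qed
qed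

lemma rep_inner_left: "rep m (\<a> (m \<diamondop> m) m m) (jxs k) T0 TM (inner Bm)"
  unfolding rep_def
proof (intro ballI allI impI)
  fix u \<l> assume u: "u \<in> jxs k" and l: "linfun m (cd (\<a> (m \<diamondop> m) m m)) \<l>"
  from u show "\<l> (\<a> (m \<diamondop> m) m m \<cdot> T0 u) = (\<Sum>v\<in>jxs k. inner Bm v u * \<l> (TM v))"
  proof (cases rule: jxs_cases)
    case (unit h)
    then show ?thesis by (simp add: sum_inner left_None[of _ m])
  next
    case (enc i b)
    then show ?thesis using expand_lt[of b "f i \<star> \<i> (m \<diamondop> m)" \<l>] l
      by (simp add: sum_inner T_enc)
  qed
qed

text \<open>The labels of \<open>TM\<close> have the left vertex as inert index, but this associator
  keeps the right one inert; \<open>flip3\<close> translates. Only a unit in the right factor passes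
  with coefficient 1.\<close>

lemma rep_inner_right: "rep m (\<a> m m (m \<diamondop> m)) (jxs k) TM T3 (\<lambda>u v. inner Bm u (flip3 v))"
  unfolding rep_def
proof (intro ballI allI impI)
  fix u \<l> assume u: "u \<in> jxs k" and l: "linfun m (cd (\<a> m m (m \<diamondop> m))) \<l>"
  have *: "\<l> (\<a> m m (m \<diamondop> m) \<cdot> TM u) = (\<Sum>v\<in>jxs k. inner Bm v (flip3 u) * \<l> (T3 v))"
    if "flip3 u = enc i b" "i < k" "b \<in> ixs k"
      "\<a> m m (m \<diamondop> m) \<cdot> TM u = (\<i> m \<star> (\<i> m \<star> f i)) \<cdot> \<a> m m m \<cdot> lt b" for i b
    using expand_lt[of b "\<i> m \<star> (\<i> m \<star> f i)" \<l>] l that by (simp add: sum_inner T_enc)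
  show "\<l> (\<a> m m (m \<diamondop> m) \<cdot> TM u) = (\<Sum>v\<in>jxs k. inner Bm v (flip3 u) * \<l> (T3 v))"
  proof (cases u rule: flip3.cases)
    case (1 h)
    then show ?thesis using u assoc_comp_right[of c "f h" "li m" m m]
      by (intro *[of h None]) (simp_all add: lt_def)
  next
    case (2 i j h)
    then show ?thesis using u assoc_comp_right[of "f i" "f j" "f h" m m]
      by (intro *[of j "Some (i, h)"]) (simp_all add: lt_def)
  next
    case (3 i)
    then show ?thesis using u by (simp add: sum_inner right_None[of _ m])
  qed
qed

lemma TM_arr [simp]:
  assumes "u \<in> jxs k"
  shows "arr (TM u)" "dm (TM u) = m" "cd (TM u) = (m \<diamondop> m) \<diamondop> (m \<diamondop> m)"
  using assms by (cases u rule: TM.cases; simp)+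

definition T3_dual :: "ix \<times> nat + nat \<Rightarrow> 'm" where
  "T3_dual u = (case u of Inl (a, h) \<Rightarrow> p h \<cdot> (\<i> m \<star> rd a) | Inr i \<Rightarrow> ru C m \<cdot> (\<i> m \<star> (e \<cdot> (\<i> m \<star> p i))))"

lemma T3_dual_arr [simp]:
  assumes "u \<in> jxs k"
  shows "arr (T3_dual u)" "dm (T3_dual u) = m \<diamondop> (m \<diamondop> (m \<diamondop> m))" "cd (T3_dual u) = m"
  using assms by (cases u; force simp: T3_dual_def)+

lemma T3_dual_T3:
  assumes u: "u \<in> jxs k" and w: "w \<in> jxs k"
  shows "T3_dual u \<cdot> T3 w = (if w = u then \<i> m else mzero C m m)"
proof (cases u; cases w)
  fix x y assume "u = Inl x" "w = Inl y"
  then obtain a h b h' where [simp]: "u = Inl (a, h)" "a \<in> ixs k" "h < k" "w = Inl (b, h')" "b \<in> ixs k" "h' < k"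
    using u w by (cases x; cases y) simp
  have "T3_dual u \<cdot> T3 w = p h \<cdot> (\<i> m \<star> (rd a \<cdot> rt b)) \<cdot> f h'"
    by (simp add: T3_dual_def interchange_comp)
  then show ?thesis by (simp add: rd_rt pf)
next
  fix x i assume "u = Inl x" and [simp]: "w = Inr i"
  then obtain a h where [simp]: "u = Inl (a, h)" "a \<in> ixs k" "h < k" "i < k"
    using u w by (cases x) simp
  have "T3_dual u \<cdot> T3 w = p h \<cdot> (\<i> m \<star> (rd a \<cdot> rc i)) \<cdot> ri m"
    by (simp add: T3_dual_def interchange_comp)
  moreover have "rd a \<cdot> rc i = mzero C E m" by (rule Hom_unit_m) simp_all
  ultimately show ?thesis by simp
next
  fix y i assume "w = Inl y" and [simp]: "u = Inr i"
  then obtain b h where [simp]: "w = Inl (b, h)" "b \<in> ixs k" "h < k" "i < k"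
    using u w by (cases y) simp
  have "T3_dual u \<cdot> T3 w = ru C m \<cdot> (\<i> m \<star> ((e \<cdot> (\<i> m \<star> p i)) \<cdot> rt b)) \<cdot> f h"
    by (simp add: T3_dual_def interchange_comp)
  moreover have "(e \<cdot> (\<i> m \<star> p i)) \<cdot> rt b = mzero C m E" by (rule Hom_m_unit) simp_all
  ultimately show ?thesis by simp
next
  fix i j assume [simp]: "u = Inr i" "w = Inr j"
  then have [simp]: "i < k" "j < k" using u w by simp_all
  have "T3_dual u \<cdot> T3 w = ru C m \<cdot> (\<i> m \<star> (e \<cdot> (\<i> m \<star> (p i \<cdot> f j)) \<cdot> c)) \<cdot> ri m"
    by (simp add: T3_dual_def rc_def interchange_comp)
  then show ?thesis by (simp add: pf ec)
qed

lemma pentagon_m: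
  assumes "u \<in> jxs k" "v \<in> jxs k"
  shows "mmul (jxs k) (outer Am Bm) (mmul (jxs k) (inner Bm) (outer Am Bm)) u v
    = mmul (jxs k) (\<lambda>u v. inner Bm u (flip3 v)) (inner Bm) u v"
proof -
  let ?P = "(\<i> m \<star> \<a> m m m) \<cdot> \<a> m (m \<diamondop> m) m \<cdot> (\<a> m m m \<star> \<i> m)"
  have r1: "rep m ?P (jxs k) T0 T3 (mmul (jxs k) (outer Am Bm) (mmul (jxs k) (inner Bm) (outer Am Bm)))"
    by (intro rep_comp[OF rep_comp[OF rep_outer_left rep_inner_mid] rep_outer_right]) simp_all
  have "rep m (\<a> m m (m \<diamondop> m) \<cdot> \<a> (m \<diamondop> m) m m) (jxs k) T0 T3
      (mmul (jxs k) (\<lambda>u v. inner Bm u (flip3 v)) (inner Bm))"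
    by (intro rep_comp[OF rep_inner_left rep_inner_right]) simp_all
  then have r2: "rep m ?P (jxs k) T0 T3 (mmul (jxs k) (\<lambda>u v. inner Bm u (flip3 v)) (inner Bm))"
    by (simp only: pentagon m_obj)
  let ?l = "\<lambda>g. sc m (T3_dual u \<cdot> g)"
  have l: "linfun m (cd ?P) ?l"
    using assms by (intro linfun_comp[OF linfun_sc[OF simple_m]]) simp_all
  have d: "?l (T3 w) = (if w = u then 1 else 0)" if w: "w \<in> jxs k" for w
    using T3_dual_T3[OF assms(1) w] linfun_zero[OF linfun_sc[OF simple_m]] by (simp add: sc_ident[OF simple_m])
  show ?thesis by (rule rep_unique[OF r1 r2 _ assms(2,1) l d]) simp
qed

text \<open>If the coefficient were zero, every zig-zag through \<open>m\<close> would vanish. The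
  dual of \<open>m\<close> is not known to be \<open>m\<close>, so its identity is resolved into
  simple summands. Each contributes zero to the zig-zag of \<open>m\<close>, although the whole is
  \<open>\<i> m\<close>.\<close>

lemma unit_coefficient_nonzero: "Bm None None \<noteq> 0"
proof
  assume \<beta>: "Bm None None = 0"
  \<comment> \<open>Since \<open>v\<close> kills every \<open>f i\<close>, only the tree
    \<open>rt None\<close> can contribute, and its coefficient is the one assumed to be
    zero.\<close>
  have van: "sc m (ru C m \<cdot> (\<i> m \<star> v) \<cdot> \<a> m m m \<cdot> lt None) = 0"
    if v: "arr v" "dm v = m \<diamondop> m" "cd v = E" for v
  proof -
    have "sc m ((ru C m \<cdot> (\<i> m \<star> v)) \<cdot> \<a> m m m \<cdot> lt None)
        = (\<Sum>a\<in>ixs k. Bm a None * sc m ((ru C m \<cdot> (\<i> m \<star> v)) \<cdot> rt a))"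
      using v linfun_sc[OF simple_m] by (intro expand_lt) simp_all
    also have "\<dots> = (\<Sum>a\<in>ixs k. 0)"
    proof (rule sum.cong[OF refl])
      fix a assume "a \<in> ixs k"
      then show "Bm a None * sc m ((ru C m \<cdot> (\<i> m \<star> v)) \<cdot> rt a) = 0"
      proof (cases rule: ixs_cases)
        case (2 i j)
        have "v \<cdot> f i = mzero C m E" by (rule Hom_m_unit) (use v 2 in simp_all)
        then have "(ru C m \<cdot> (\<i> m \<star> v)) \<cdot> rt a = mzero C m m"
          using v 2 by (simp add: rt_def interchange_comp)
        then show ?thesis using linfun_zero[OF linfun_sc[OF simple_m]] by simp
      qed (simp add: \<beta>)
    qed
    finally show ?thesis using v by simp
  qed
  let ?y = "dual C m" and ?u = "coev C m" and ?v = "ev C m"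
  have rig: "?y \<in> Obj C \<and> ?v \<in> Hom C (?y \<diamondop> m) E \<and> ?u \<in> Hom C E (m \<diamondop> ?y) \<and>
     ru C m \<cdot> (\<i> m \<star> ?v) \<cdot> \<a> m ?y m \<cdot> (?u \<star> \<i> m) = lu C m"
    using rigid[unfolded rigid_def, rule_format, OF m_obj] by (elim conjE) (intro conjI)
  then have y [simp]: "?y \<in> Obj C" and u [simp]: "arr ?u" "dm ?u = E" "cd ?u = m \<diamondop> ?y"
    and v [simp]: "arr ?v" "dm ?v = ?y \<diamondop> m" "cd ?v = E"
    by (simp_all add: Hom_iff)
  \<comment> \<open>The zig-zag of \<open>m\<close> with an endomorphism \<open>z\<close> of the
    dual inserted on the dual strand; it is linear in \<open>z\<close> and yields
    \<open>\<i> m\<close> at the identity.\<close>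
  define Z where "Z z = ru C m \<cdot> (\<i> m \<star> ?v) \<cdot> \<a> m ?y m \<cdot> (((\<i> m \<star> z) \<cdot> ?u) \<star> \<i> m) \<cdot> li m" for z
  have "Z (\<i> ?y) = (ru C m \<cdot> (\<i> m \<star> ?v) \<cdot> \<a> m ?y m \<cdot> (?u \<star> \<i> m)) \<cdot> li m" by (simp add: Z_def)
  also have "\<dots> = lu C m \<cdot> li m" using rig by simp
  finally have Z1: "Z (\<i> ?y) = \<i> m" by simp
  have Z_lin: "linfun ?y ?y (\<lambda>z. sc m (Z z))"
  proof -
    have "linfun m ((m \<diamondop> ?y) \<diamondop> m) (\<lambda>g. sc m ((ru C m \<cdot> (\<i> m \<star> ?v) \<cdot> \<a> m ?y m) \<cdot> g))"
      by (rule linfun_comp[OF linfun_sc[OF simple_m]]) simp_all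
    then have "linfun (E \<diamondop> m) ((m \<diamondop> ?y) \<diamondop> m) (\<lambda>g. sc m ((ru C m \<cdot> (\<i> m \<star> ?v) \<cdot> \<a> m ?y m) \<cdot> g \<cdot> li m))"
      by (rule linfun_comp_right) simp_all
    then have "linfun E (m \<diamondop> ?y) (\<lambda>g. sc m ((ru C m \<cdot> (\<i> m \<star> ?v) \<cdot> \<a> m ?y m) \<cdot> (g \<star> \<i> m) \<cdot> li m))"
      using linfun_tensor_left[of E "\<i> m" "m \<diamondop> ?y" "\<lambda>g. sc m ((ru C m \<cdot> (\<i> m \<star> ?v) \<cdot> \<a> m ?y m) \<cdot> g \<cdot> li m)"] by simp
    then have "linfun (m \<diamondop> ?y) (m \<diamondop> ?y) (\<lambda>g. sc m ((ru C m \<cdot> (\<i> m \<star> ?v) \<cdot> \<a> m ?y m) \<cdot> ((g \<cdot> ?u) \<star> \<i> m) \<cdot> li m))"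
      by (rule linfun_comp_right) simp_all
    then have "linfun ?y ?y (\<lambda>z. sc m ((ru C m \<cdot> (\<i> m \<star> ?v) \<cdot> \<a> m ?y m) \<cdot> (((\<i> m \<star> z) \<cdot> ?u) \<star> \<i> m) \<cdot> li m))"
      using linfun_tensor_right[of "\<i> m" ?y ?y "\<lambda>g. sc m ((ru C m \<cdot> (\<i> m \<star> ?v) \<cdot> \<a> m ?y m) \<cdot> ((g \<cdot> ?u) \<star> \<i> m) \<cdot> li m)"] by simp
    then show ?thesis by (auto simp: linfun_def Z_def)
  qed
  have Z0: "sc m (Z (q \<cdot> r)) = 0"
    if q: "arr q" "dm q = x" "cd q = ?y" and r: "arr r" "dm r = ?y" "cd r = x" and x: "x = E \<or> x = m" for q r x
  proof -
    have [simp]: "x \<in> Obj C" using x by auto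
    \<comment> \<open>The factor \<open>r\<close> is absorbed into the coevaluation and
      \<open>q\<close> into the evaluation, so the dual strand becomes \<open>x\<close>.\<close>
    let ?u' = "(\<i> m \<star> r) \<cdot> ?u" and ?v' = "?v \<cdot> (q \<star> \<i> m)"
    have u': "arr ?u'" "dm ?u' = E" "cd ?u' = m \<diamondop> x" using r by simp_all
    have v': "arr ?v'" "dm ?v' = x \<diamondop> m" "cd ?v' = E" using q by simp_all
    have "(\<i> m \<star> (q \<cdot> r)) \<cdot> ?u = (\<i> m \<star> q) \<cdot> ?u'" using q r by (simp add: interchange_comp)
    then have "\<a> m ?y m \<cdot> (((\<i> m \<star> (q \<cdot> r)) \<cdot> ?u) \<star> \<i> m) \<cdot> li m
        = (\<i> m \<star> (q \<star> \<i> m)) \<cdot> \<a> m x m \<cdot> (?u' \<star> \<i> m) \<cdot> li m"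
      using q u' assoc_comp_mid[of q ?u' "li m" m m ?y] by simp
    then have Zq: "Z (q \<cdot> r) = ru C m \<cdot> (\<i> m \<star> ?v') \<cdot> \<a> m x m \<cdot> (?u' \<star> \<i> m) \<cdot> li m"
      using q u' by (simp add: Z_def interchange_comp)
    from x show ?thesis
    proof
      assume [simp]: "x = E"
      \<comment> \<open>For \<open>x = E\<close> the modified coevaluation amounts to an arrow from
        \<open>E\<close> to \<open>m\<close>, hence vanishes.\<close>
      have "?u' = (ri m \<cdot> ru C m) \<cdot> ?u'" using u' by simp
      also have "\<dots> = ri m \<cdot> (ru C m \<cdot> ?u')" using u' by (simp del: unitor_inv(9))
      also have "ru C m \<cdot> ?u' = mzero C E m" by (rule Hom_unit_m) (use u' in simp_all)
      finally have "?u' = mzero C E (m \<diamondop> x)" by simp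
      then have "Z (q \<cdot> r) = mzero C m m" unfolding Zq using v' by simp
      then show ?thesis using linfun_zero[OF linfun_sc[OF simple_m]] by simp
    next
      assume [simp]: "x = m"
      let ?F = "\<lambda>g. sc m ((ru C m \<cdot> (\<i> m \<star> ?v') \<cdot> \<a> m m m) \<cdot> (g \<star> \<i> m) \<cdot> li m)"
      have l: "linfun E (m \<diamondop> m) ?F"
      proof -
        have "linfun m ((m \<diamondop> m) \<diamondop> m) (\<lambda>g. sc m ((ru C m \<cdot> (\<i> m \<star> ?v') \<cdot> \<a> m m m) \<cdot> g))"
          using v' by (intro linfun_comp[OF linfun_sc[OF simple_m]]) simp_all
        then have "linfun (E \<diamondop> m) ((m \<diamondop> m) \<diamondop> m) (\<lambda>g. sc m ((ru C m \<cdot> (\<i> m \<star> ?v') \<cdot> \<a> m m m) \<cdot> g \<cdot> li m))"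
          by (rule linfun_comp_right) simp_all
        then show ?thesis
          using linfun_tensor_left[of E "\<i> m" "m \<diamondop> m" "\<lambda>g. sc m ((ru C m \<cdot> (\<i> m \<star> ?v') \<cdot> \<a> m m m) \<cdot> g \<cdot> li m)"] by simp
      qed
      \<comment> \<open>For \<open>x = m\<close> the resolution of m \<otimes> m shows that only the
        multiple of \<open>c\<close> in \<open>?u'\<close> counts, and \<open>van\<close> disposes
        of it.\<close>
      have "?F ?u' = ?F (c \<cdot> e \<cdot> ?u') + (\<Sum>i<k. ?F (f i \<cdot> p i \<cdot> ?u'))"
        by (rule expand_mm[OF _ _ _ l]) (use u' in simp_all)
      also have "(\<Sum>i<k. ?F (f i \<cdot> p i \<cdot> ?u')) = (\<Sum>i<k. 0)"
      proof (rule sum.cong[OF refl])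
        fix i assume "i \<in> {..<k}"
        then have "p i \<cdot> ?u' = mzero C E m" using u' by (intro Hom_unit_m) simp_all
        then have "f i \<cdot> p i \<cdot> ?u' = mzero C E (m \<diamondop> m)" using \<open>i \<in> {..<k}\<close> by simp
        then show "?F (f i \<cdot> p i \<cdot> ?u') = 0" using linfun_zero[OF l] by simp
      qed
      also have "?F (c \<cdot> e \<cdot> ?u') = sc E (e \<cdot> ?u') * ?F c"
      proof -
        define s where "s = sc E (e \<cdot> ?u')"
        have eq: "e \<cdot> ?u' = msmul C s (\<i> E)"
          unfolding s_def using u' by (intro smul_sc simple_unit) simp_all
        have "c \<cdot> e \<cdot> ?u' = msmul C s c" unfolding eq using comp_linear(1)[of "\<i> E" c] by simp
        then show ?thesis using linfun_smul[OF l, of c] by (simp add: s_def)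
      qed
      also have "?F c = 0" using van[of ?v'] v' by (simp add: lt_def)
      finally show ?thesis unfolding Zq using u' v' by simp
    qed
  qed
  obtain xs where xs: "\<forall>s\<in>set xs. simple C s" "dsum C ?y xs" using semisimple[OF y] by blast
  from xs(2) obtain \<iota> \<pi> where
    \<iota>: "\<And>i. i < length xs \<Longrightarrow> arr (\<iota> i) \<and> dm (\<iota> i) = xs ! i \<and> cd (\<iota> i) = ?y"
    and \<pi>: "\<And>i. i < length xs \<Longrightarrow> arr (\<pi> i) \<and> dm (\<pi> i) = ?y \<and> cd (\<pi> i) = xs ! i"
    and id: "\<And>\<l>. linfun ?y ?y \<l> \<Longrightarrow> \<l> (\<i> ?y) = (\<Sum>i<length xs. \<l> (\<iota> i \<cdot> \<pi> i))"
    by (rule dsumE) blast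
  have "sc m (Z (\<iota> i \<cdot> \<pi> i)) = 0" if i: "i < length xs" for i
  proof -
    have "simple C (xs ! i)" using xs(1) i by simp
    then obtain x q q' where q: "x = E \<or> x = m" "arr q" "dm q = x" "cd q = xs ! i"
      "arr q'" "dm q' = xs ! i" "cd q' = x" "q \<cdot> q' = \<i> (xs ! i)" by (rule simple_coverE)
    have "\<iota> i \<cdot> \<pi> i = \<iota> i \<cdot> (q \<cdot> q') \<cdot> \<pi> i" using \<iota>[OF i] \<pi>[OF i] q(8) by simp
    also have "\<dots> = (\<iota> i \<cdot> q) \<cdot> (q' \<cdot> \<pi> i)" using \<iota>[OF i] \<pi>[OF i] q(2-7) by simp
    finally show ?thesis using Z0[of "\<iota> i \<cdot> q" x "q' \<cdot> \<pi> i"] \<iota>[OF i] \<pi>[OF i] q(1-7) by simp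
  qed
  then have "sc m (Z (\<i> ?y)) = 0" using id[OF Z_lin] by simp
  then show False by (simp add: Z1 sc_ident[OF simple_m])
qed

end

theorem theorem1p4:
  fixes C :: "('o, 'm, 'r::field) cat_data" and k :: nat
  assumes "(2::'r) \<noteq> 0"
    and "k \<ge> 1"
    and "k mod 4 = 2 \<or> k mod 4 = 3"
  shows "\<not> (\<exists>m. near_group_trivial C m k)"
proof
  assume "\<exists>m. near_group_trivial C m k"
  then obtain m where ng: "near_group_trivial C m k" ..
  interpret near_group_category C m k
    using ng by unfold_locales (auto simp: near_group_trivial_def)
  let ?xs = "E # replicate k m"
  from dsum_mm obtain \<iota> \<pi> where
    \<iota>: "\<And>i. i < length ?xs \<Longrightarrow> arr (\<iota> i) \<and> dm (\<iota> i) = ?xs ! i \<and> cd (\<iota> i) = m \<diamondop> m"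
    and \<pi>: "\<And>i. i < length ?xs \<Longrightarrow> arr (\<pi> i) \<and> dm (\<pi> i) = m \<diamondop> m \<and> cd (\<pi> i) = ?xs ! i"
    and orth: "\<And>i j. i < length ?xs \<Longrightarrow> j < length ?xs \<Longrightarrow>
      \<pi> i \<cdot> \<iota> j = (if i = j then \<i> (?xs ! i) else mzero C (?xs ! j) (?xs ! i))"
    and id: "\<And>\<l>. linfun (m \<diamondop> m) (m \<diamondop> m) \<l> \<Longrightarrow> \<l> (\<i> (m \<diamondop> m)) = (\<Sum>i<length ?xs. \<l> (\<iota> i \<cdot> \<pi> i))"
    by (rule dsumE) blast
  \<comment> \<open>The unit is entry 0 of the list of summands, so the copies of \<open>m\<close>
    have indices shifted by \<open>Suc\<close>.\<close>
  interpret near_group_basis C m k "\<iota> 0" "\<pi> 0" "\<lambda>i. \<iota> (Suc i)" "\<lambda>i. \<pi> (Suc i)"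
  proof unfold_locales
    fix \<l> assume "linfun (m \<diamondop> m) (m \<diamondop> m) \<l>"
    from id[OF this] show "\<l> (\<i> (m \<diamondop> m)) = \<l> (\<iota> 0 \<cdot> \<pi> 0) + (\<Sum>i<k. \<l> (\<iota> (Suc i) \<cdot> \<pi> (Suc i)))"
      by (simp add: sum.lessThan_Suc_shift del: sum.lessThan_Suc)
  qed (use \<iota>[of 0] \<pi>[of 0] orth[of 0 0] in simp_all, use \<iota>[of "Suc _"] \<pi>[of "Suc _"] orth[of "Suc _" "Suc _"] in simp_all)
  show False
    by (rule no_matrix_solution[OF assms(1,3) unit_coefficient_nonzero pentagon_unit pentagon_m])
qed

end
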